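(* Assume there exists a completely separable MAD family of subsets of $\omega$. Then the modal logic $\mathsf{S4}$ is the logic of the space $\omega^*$: for every set of modal formulas $\Gamma$ and every modal formula $\varphi$, $\Gamma\vdash_{\mathsf{S4}}\varphi$ if and only if $\Gamma\models_{\omega^*}\varphi$.
   Context: $\mathsf{S4}$ is axiomatized by classical propositional logic plus the schemata $\Box(\varphi\to\psi)\to(\Box\varphi\to\Box\psi)$, $\Box\varphi\to\varphi$, $\Box\varphi\to\Box\Box\varphi$, with modus ponens and necessitation $\varphi/\Box\varphi$; $\Diamond\varphi=\neg\Box\neg\varphi$. A topological model on a space $X$ is a valuation where Boolean connectives are pointwise and $x\Vdash\Box\varphi$ iff some open $U\ni x$ has $y\Vdash\varphi$ for all $y\in U$. $\Gamma\models_X\varphi$ means every topological model on $X$ validating all formulas of $\Gamma$ at every point validates $\varphi$ at every point. $\omega^*=\beta\omega\setminus\omega$ is the space of nonprincipal ultrafilters on $\omega$. An AD family is $\mathcal A\subseteq[\omega]^\omega$ with pairwise finite intersections; MAD means infinite and inclusion-maximal; $\mathcal A$ is completely separable if every $X\subseteq\omega$ not in the ideal generated by $\mathcal A$ and finite sets is either almost disjoint from all members of $\mathcal A$ or satisfies $A\setminus X$ finite for some $A\in\mathcal A$. *)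

theory Defs
  imports "HOL-Analysis.Abstract_Topology"
begin

section \<open>The modal logic S4\<close>

datatype fm =
    Var nat
  | Bot
  | Neg fm
  | And fm fm
  | Or fm fm
  | Imp fm fm
  | Box fm

abbreviation Dia :: "fm \<Rightarrow> fm" where
  "Dia \<phi> \<equiv> Neg (Box (Neg \<phi>))"

text \<open>Boolean evaluation in which variables and boxed formulas are the atoms, so that
  \<^term>\<open>tautology\<close> singles out the modal substitution instances of classical tautologies.\<close>

primrec bool_eval :: "(fm \<Rightarrow> bool) \<Rightarrow> fm \<Rightarrow> bool" where
  "bool_eval g (Var p) \<longleftrightarrow> g (Var p)"
| "bool_eval g Bot \<longleftrightarrow> False"
| "bool_eval g (Neg \<phi>) \<longleftrightarrow> \<not> bool_eval g \<phi>"
| "bool_eval g (And \<phi> \<psi>) \<longleftrightarrow> bool_eval g \<phi> \<and> bool_eval g \<psi>"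
| "bool_eval g (Or \<phi> \<psi>) \<longleftrightarrow> bool_eval g \<phi> \<or> bool_eval g \<psi>"
| "bool_eval g (Imp \<phi> \<psi>) \<longleftrightarrow> (bool_eval g \<phi> \<longrightarrow> bool_eval g \<psi>)"
| "bool_eval g (Box \<phi>) \<longleftrightarrow> g (Box \<phi>)"

definition tautology :: "fm \<Rightarrow> bool" where
  "tautology \<phi> \<longleftrightarrow> (\<forall>g. bool_eval g \<phi>)"

text \<open>Global derivability: necessitation applies to everything derived from \<open>\<Gamma>\<close>, matching
  the global semantic consequence \<open>models_space\<close> below.\<close>

inductive S4_derives :: "fm set \<Rightarrow> fm \<Rightarrow> bool" for \<Gamma> :: "fm set" where
  assm: "\<phi> \<in> \<Gamma> \<Longrightarrow> S4_derives \<Gamma> \<phi>"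
| taut: "tautology \<phi> \<Longrightarrow> S4_derives \<Gamma> \<phi>"
| axK: "S4_derives \<Gamma> (Imp (Box (Imp \<phi> \<psi>)) (Imp (Box \<phi>) (Box \<psi>)))"
| axT: "S4_derives \<Gamma> (Imp (Box \<phi>) \<phi>)"
| ax4: "S4_derives \<Gamma> (Imp (Box \<phi>) (Box (Box \<phi>)))"
| mp: "S4_derives \<Gamma> (Imp \<phi> \<psi>) \<Longrightarrow> S4_derives \<Gamma> \<phi> \<Longrightarrow> S4_derives \<Gamma> \<psi>"
| nec: "S4_derives \<Gamma> \<phi> \<Longrightarrow> S4_derives \<Gamma> (Box \<phi>)"

section \<open>Topological semantics\<close>

definition valuation_on :: "'a topology \<Rightarrow> (nat \<Rightarrow> 'a set) \<Rightarrow> bool" where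
  "valuation_on X V \<longleftrightarrow> (\<forall>p. V p \<subseteq> topspace X)"

primrec forces :: "'a topology \<Rightarrow> (nat \<Rightarrow> 'a set) \<Rightarrow> 'a \<Rightarrow> fm \<Rightarrow> bool" where
  "forces X V x (Var p) \<longleftrightarrow> x \<in> V p"
| "forces X V x Bot \<longleftrightarrow> False"
| "forces X V x (Neg \<phi>) \<longleftrightarrow> \<not> forces X V x \<phi>"
| "forces X V x (And \<phi> \<psi>) \<longleftrightarrow> forces X V x \<phi> \<and> forces X V x \<psi>"
| "forces X V x (Or \<phi> \<psi>) \<longleftrightarrow> forces X V x \<phi> \<or> forces X V x \<psi>"
| "forces X V x (Imp \<phi> \<psi>) \<longleftrightarrow> (forces X V x \<phi> \<longrightarrow> forces X V x \<psi>)"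
| "forces X V x (Box \<phi>) \<longleftrightarrow> (\<exists>U. openin X U \<and> x \<in> U \<and> (\<forall>y\<in>U. forces X V y \<phi>))"

definition validates :: "'a topology \<Rightarrow> (nat \<Rightarrow> 'a set) \<Rightarrow> fm \<Rightarrow> bool" where
  "validates X V \<phi> \<longleftrightarrow> (\<forall>x\<in>topspace X. forces X V x \<phi>)"

definition models_space :: "'a topology \<Rightarrow> fm set \<Rightarrow> fm \<Rightarrow> bool" where
  "models_space X \<Gamma> \<phi> \<longleftrightarrow>
    (\<forall>V. valuation_on X V \<longrightarrow> (\<forall>\<gamma>\<in>\<Gamma>. validates X V \<gamma>) \<longrightarrow> validates X V \<phi>)"

section \<open>The space of nonprincipal ultrafilters on the natural numbers\<close>

definition ultrafilter :: "'a filter \<Rightarrow> bool" where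
  "ultrafilter F \<longleftrightarrow> F \<noteq> bot \<and>
    (\<forall>A. eventually (\<lambda>n. n \<in> A) F \<or> eventually (\<lambda>n. n \<notin> A) F)"

definition beta_omega :: "nat filter topology" where
  "beta_omega = topology_generated_by
    (range (\<lambda>A. {F. ultrafilter F \<and> eventually (\<lambda>n. n \<in> A) F}))"

text \<open>The natural number \<open>n\<close> is identified with the principal ultrafilter at \<open>n\<close>.\<close>

definition omega_star :: "nat filter topology" where
  "omega_star = subtopology beta_omega (topspace beta_omega - range (\<lambda>n. principal {n}))"

section \<open>Almost disjoint families\<close>

definition AD_family :: "nat set set \<Rightarrow> bool" where
  "AD_family \<A> \<longleftrightarrow> (\<forall>A\<in>\<A>. infinite A) \<and> (\<forall>A\<in>\<A>. \<forall>B\<in>\<A>. A \<noteq> B \<longrightarrow> finite (A \<inter> B))"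

definition MAD_family :: "nat set set \<Rightarrow> bool" where
  "MAD_family \<A> \<longleftrightarrow> AD_family \<A> \<and> infinite \<A> \<and> (\<forall>\<B>. AD_family \<B> \<and> \<A> \<subseteq> \<B> \<longrightarrow> \<B> = \<A>)"

definition set_ideal :: "'a set set \<Rightarrow> bool" where
  "set_ideal I \<longleftrightarrow> {} \<in> I \<and> (\<forall>X\<in>I. \<forall>Y\<subseteq>X. Y \<in> I) \<and> (\<forall>X\<in>I. \<forall>Y\<in>I. X \<union> Y \<in> I)"

definition completely_separable :: "nat set set \<Rightarrow> bool" where
  "completely_separable \<A> \<longleftrightarrow>
    (\<forall>X. X \<notin> set_ideal hull (\<A> \<union> {F. finite F}) \<longrightarrow>
      (\<forall>A\<in>\<A>. finite (A \<inter> X)) \<or> (\<exists>A\<in>\<A>. finite (A - X)))"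

end

theory Submission
  imports Defs "HOL-Library.Bourbaki_Witt_Fixpoint" "HOL-Library.Countable_Set"
    "HOL-Library.Nat_Bijection" "HOL-Library.Disjoint_Sets" "HOL-Library.Infinite_Set"
begin

text \<open>
  Suppose that \<open>\<phi>\<close> is not derivable from \<open>\<Gamma>\<close>. The points of \<open>\<omega>*\<close> are labelled by maximal consistent sets
  so that \<open>Box \<psi>\<close> belongs to the label of \<open>x\<close> iff \<open>\<psi>\<close> belongs to all labels near \<open>x\<close>. Since \<open>\<Gamma>\<close> may be
  infinite, the finite model property is of no help and the labelling is transfinite.

  Write \<open>A*\<close> for the clopen set of ultrafilters containing \<open>A\<close>. A completely separable MAD family \<open>\<A>\<close> can be
  coloured with countably many colours so that every set outside its ideal almost contains members
  of every colour. Hence near each point of the nowhere dense set \<open>F = \<omega>* - \<Union>{A*. A \<in> \<A>}\<close> there are sets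
  \<open>A*\<close> of every colour, while \<open>F\<close> itself is a union of countably many disjoint dense subsets. Given a
  maximal consistent set \<open>w\<close>, the points of \<open>F\<close> get labels from the cluster of \<open>w\<close>, and each \<open>A*\<close> is
  passed on, according to the colour of \<open>A\<close>, to a cluster strictly above \<open>w\<close>; in \<open>A*\<close>, which is
  homeomorphic to \<open>\<omega>*\<close>, the process is repeated. At limit stages one is left with a countable
  decreasing intersection of clopen sets; it is homeomorphic to \<open>\<omega>* - \<Union>n. A\<^sub>n*\<close> for distinct members
  \<open>A\<^sub>n\<close> of \<open>\<A>\<close>, so that the remaining members of \<open>\<A>\<close> serve there in the same way. As the box parts
  strictly increase and there are only countably many formulas, the process stops at every point
  after countably many steps.
\<close>

unbundle cardinal_syntax

instance fm :: countable
  by countable_datatype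

section \<open>Soundness\<close>

text \<open>Truth at \<open>x\<close> is itself an assignment of truth values to variables and boxed
  formulas, so every tautology is forced at \<open>x\<close>.\<close>

lemma bool_eval_forces: "bool_eval (forces X V x) \<phi> = forces X V x \<phi>"
  by (induction \<phi>) auto

lemma S4_derives_sound:
  assumes "S4_derives \<Gamma> \<phi>" and "\<forall>\<gamma>\<in>\<Gamma>. validates X V \<gamma>"
  shows "validates X V \<phi>"
  using assms(1)
proof induction
  case (assm \<phi>)
  then show ?case using assms(2) by blast
next
  case (taut \<phi>)
  then show ?case
    unfolding tautology_def validates_def using bool_eval_forces by fast
next
  case (axK \<phi> \<psi>)
  have "forces X V x (Box \<psi>)"
    if imp: "forces X V x (Box (Imp \<phi> \<psi>))" and ante: "forces X V x (Box \<phi>)" for x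
  proof -
    from imp obtain U where U: "openin X U" "x \<in> U" "\<forall>y\<in>U. forces X V y \<phi> \<longrightarrow> forces X V y \<psi>"
      by auto
    from ante obtain U' where U': "openin X U'" "x \<in> U'" "\<forall>y\<in>U'. forces X V y \<phi>"
      by auto
    have "openin X (U \<inter> U')" "x \<in> U \<inter> U'" "\<forall>y\<in>U \<inter> U'. forces X V y \<psi>"
      using U U' by auto
    then show ?thesis unfolding forces.simps by (intro exI conjI)
  qed
  then show ?case by (simp add: validates_def)
next
  case (axT \<phi>)
  then show ?case unfolding validates_def forces.simps by blast
next
  case (ax4 \<phi>)
  then show ?case unfolding validates_def forces.simps by blast
next
  case (mp \<phi> \<psi>)
  then show ?case by (auto simp: validates_def)
next
  case (nec \<phi>)
  then show ?case unfolding validates_def forces.simps by (blast intro: openin_topspace)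
qed

section \<open>Maximal consistent sets\<close>

lemma bool_eval_foldr_Imp:
  "bool_eval g (foldr Imp xs \<phi>) \<longleftrightarrow> ((\<forall>x\<in>set xs. bool_eval g x) \<longrightarrow> bool_eval g \<phi>)"
  by (induction xs) auto

lemma S4_derives_taut_mp:
  assumes "S4_derives \<Gamma> \<phi>" and "\<And>g. bool_eval g \<phi> \<Longrightarrow> bool_eval g \<psi>"
  shows "S4_derives \<Gamma> \<psi>"
  using S4_derives.mp[OF S4_derives.taut assms(1)] assms(2) by (simp add: tautology_def)

lemma S4_derives_taut_mp2:
  assumes "S4_derives \<Gamma> \<phi>" "S4_derives \<Gamma> \<chi>"
    and "\<And>g. bool_eval g \<phi> \<Longrightarrow> bool_eval g \<chi> \<Longrightarrow> bool_eval g \<psi>"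
  shows "S4_derives \<Gamma> \<psi>"
proof -
  have "S4_derives \<Gamma> (Imp \<chi> \<psi>)"
    by (rule S4_derives_taut_mp[OF assms(1)]) (use assms(3) in auto)
  then show ?thesis using assms(2) S4_derives.mp by blast
qed

text \<open>\<open>\<Gamma>\<close> holds globally and may be necessitated, whereas
  \<open>\<Delta>\<close> enters only through premises of implications: the deduction theorem fails
  once assumptions are necessitated.\<close>

definition consistent :: "fm set \<Rightarrow> fm set \<Rightarrow> bool" where
  "consistent \<Gamma> \<Delta> \<longleftrightarrow> (\<forall>xs. set xs \<subseteq> \<Delta> \<longrightarrow> \<not> S4_derives \<Gamma> (foldr Imp xs Bot))"

definition mcs :: "fm set \<Rightarrow> fm set \<Rightarrow> bool" where
  "mcs \<Gamma> w \<longleftrightarrow> (\<forall>\<phi>. S4_derives \<Gamma> \<phi> \<longrightarrow> \<phi> \<in> w) \<and>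
    (\<forall>\<phi> \<psi>. Imp \<phi> \<psi> \<in> w \<longrightarrow> \<phi> \<in> w \<longrightarrow> \<psi> \<in> w) \<and> (\<forall>\<phi>. Neg \<phi> \<in> w \<longleftrightarrow> \<phi> \<notin> w)"

lemma mcs_derives: "mcs \<Gamma> w \<Longrightarrow> S4_derives \<Gamma> \<phi> \<Longrightarrow> \<phi> \<in> w"
  by (simp add: mcs_def)

lemma mcs_mp: "mcs \<Gamma> w \<Longrightarrow> Imp \<phi> \<psi> \<in> w \<Longrightarrow> \<phi> \<in> w \<Longrightarrow> \<psi> \<in> w"
  unfolding mcs_def by blast

lemma mcs_Neg: "mcs \<Gamma> w \<Longrightarrow> Neg \<phi> \<in> w \<longleftrightarrow> \<phi> \<notin> w"
  by (simp add: mcs_def)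

lemma mcs_foldr_Imp: "mcs \<Gamma> w \<Longrightarrow> foldr Imp xs \<phi> \<in> w \<Longrightarrow> set xs \<subseteq> w \<Longrightarrow> \<phi> \<in> w"
  by (induction xs) (auto dest: mcs_mp)

lemma mcs_taut:
  assumes "mcs \<Gamma> w" "set xs \<subseteq> w"
    and "\<And>g. (\<forall>x\<in>set xs. bool_eval g x) \<Longrightarrow> bool_eval g \<phi>"
  shows "\<phi> \<in> w"
proof -
  have "S4_derives \<Gamma> (foldr Imp xs \<phi>)"
    by (rule S4_derives.taut) (use assms(3) in \<open>auto simp: tautology_def bool_eval_foldr_Imp\<close>)
  then show ?thesis using assms mcs_foldr_Imp mcs_derives by blast
qed

lemma mcs_Bot: "mcs \<Gamma> w \<Longrightarrow> Bot \<notin> w"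
  using mcs_derives[OF _ S4_derives.taut[of "Neg Bot"]] by (auto simp: mcs_Neg tautology_def)

lemma mcs_And:
  assumes w: "mcs \<Gamma> w"
  shows "And \<phi> \<psi> \<in> w \<longleftrightarrow> \<phi> \<in> w \<and> \<psi> \<in> w"
proof (intro iffI conjI)
  show "\<phi> \<in> w" "\<psi> \<in> w" if "And \<phi> \<psi> \<in> w"
    by (rule mcs_taut[OF w, of "[And \<phi> \<psi>]"]; use that in simp)+
  show "And \<phi> \<psi> \<in> w" if "\<phi> \<in> w \<and> \<psi> \<in> w"
    by (rule mcs_taut[OF w, of "[\<phi>, \<psi>]"]; use that in simp)
qed

lemma mcs_Imp:
  assumes w: "mcs \<Gamma> w"
  shows "Imp \<phi> \<psi> \<in> w \<longleftrightarrow> (\<phi> \<in> w \<longrightarrow> \<psi> \<in> w)"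
proof -
  have "Imp \<phi> \<psi> \<in> w" if "Neg \<phi> \<in> w"
    by (rule mcs_taut[OF w, of "[Neg \<phi>]"]; use that in simp)
  moreover have "Imp \<phi> \<psi> \<in> w" if "\<psi> \<in> w"
    by (rule mcs_taut[OF w, of "[\<psi>]"]; use that in simp)
  ultimately show ?thesis using mcs_mp[OF w] mcs_Neg[OF w] by blast
qed

lemma mcs_Or:
  assumes w: "mcs \<Gamma> w"
  shows "Or \<phi> \<psi> \<in> w \<longleftrightarrow> \<phi> \<in> w \<or> \<psi> \<in> w"
proof -
  have "Imp (Neg \<phi>) \<psi> \<in> w" if "Or \<phi> \<psi> \<in> w"
    by (rule mcs_taut[OF w, of "[Or \<phi> \<psi>]"]; use that in auto)
  moreover have "Or \<phi> \<psi> \<in> w" if "Imp (Neg \<phi>) \<psi> \<in> w"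
    by (rule mcs_taut[OF w, of "[Imp (Neg \<phi>) \<psi>]"]; use that in auto)
  ultimately show ?thesis using mcs_Imp[OF w] mcs_Neg[OF w] by blast
qed

lemma consistent_mono: "consistent \<Gamma> \<Delta> \<Longrightarrow> \<Delta>' \<subseteq> \<Delta> \<Longrightarrow> consistent \<Gamma> \<Delta>'"
  by (auto simp: consistent_def)

lemma mcs_consistent: "mcs \<Gamma> w \<Longrightarrow> consistent \<Gamma> w"
  unfolding consistent_def using mcs_Bot mcs_derives mcs_foldr_Imp by blast

lemma consistent_finite:
  assumes "\<And>\<Delta>'. finite \<Delta>' \<Longrightarrow> \<Delta>' \<subseteq> \<Delta> \<Longrightarrow> consistent \<Gamma> \<Delta>'"
  shows "consistent \<Gamma> \<Delta>"
  using assms[OF List.finite_set] unfolding consistent_def by blast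

text \<open>Copies of \<open>\<phi>\<close> are dropped from the list of premises; the others then
  refute \<open>\<phi>\<close>.\<close>

lemma inconsistent_insert:
  assumes "\<not> consistent \<Gamma> (insert \<phi> \<Delta>)"
  obtains xs where "set xs \<subseteq> \<Delta>" "S4_derives \<Gamma> (foldr Imp xs (Neg \<phi>))"
proof -
  obtain xs where xs: "set xs \<subseteq> insert \<phi> \<Delta>" "S4_derives \<Gamma> (foldr Imp xs Bot)"
    using assms by (auto simp: consistent_def)
  show ?thesis
  proof
    show "set (filter (\<lambda>x. x \<noteq> \<phi>) xs) \<subseteq> \<Delta>" using xs(1) by auto
    show "S4_derives \<Gamma> (foldr Imp (filter (\<lambda>x. x \<noteq> \<phi>) xs) (Neg \<phi>))"
      by (rule S4_derives_taut_mp[OF xs(2)]) (auto simp: bool_eval_foldr_Imp)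
  qed
qed

text \<open>Zorn's lemma: only finitely many premises enter a derivation, so unions of nonempty
  chains of consistent sets are consistent.\<close>

lemma mcs_extension:
  assumes "consistent \<Gamma> \<Delta>"
  obtains w where "mcs \<Gamma> w" "\<Delta> \<subseteq> w"
proof -
  define Q where "Q = {\<Delta>'. \<Delta> \<subseteq> \<Delta>' \<and> consistent \<Gamma> \<Delta>'}"
  have chain: "\<Union>C \<in> Q" if C: "C \<noteq> {}" "subset.chain Q C" for C
  proof -
    have "consistent \<Gamma> (\<Union>C)"
    proof (rule consistent_finite)
      fix \<Delta>' assume "finite \<Delta>'" "\<Delta>' \<subseteq> \<Union>C"
      then obtain B where "B \<in> C" "\<Delta>' \<subseteq> B"
        using finite_subset_Union_chain C by metis
      then show "consistent \<Gamma> \<Delta>'"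
        using C by (auto simp: Q_def subset.chain_def intro: consistent_mono)
    qed
    moreover have "\<Delta> \<subseteq> \<Union>C" using C unfolding Q_def subset.chain_def by blast
    ultimately show ?thesis by (simp add: Q_def)
  qed
  have "Q \<noteq> {}" using assms by (auto simp: Q_def)
  then obtain w where w: "w \<in> Q" and max: "\<And>w'. w' \<in> Q \<Longrightarrow> w \<subseteq> w' \<Longrightarrow> w' = w"
    using subset_Zorn_nonempty[of Q] chain by metis
  have con: "consistent \<Gamma> w" and "\<Delta> \<subseteq> w" using w by (auto simp: Q_def)
  have ins: "\<phi> \<in> w" if "consistent \<Gamma> (insert \<phi> w)" for \<phi>
    using max[of "insert \<phi> w"] that \<open>\<Delta> \<subseteq> w\<close> by (auto simp: Q_def)
  \<comment> \<open>Maximality gives deductive closure: if \<open>\<phi>\<close> could not be added,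
    \<open>Neg \<phi>\<close> would follow from \<open>w\<close> besides \<open>\<phi>\<close>, and
    \<open>w\<close> would be inconsistent.\<close>
  have closed: "\<phi> \<in> w" if "set xs \<subseteq> w" "S4_derives \<Gamma> (foldr Imp xs \<phi>)" for xs \<phi>
  proof (rule ins, rule ccontr)
    assume "\<not> consistent \<Gamma> (insert \<phi> w)"
    then obtain ys where "set ys \<subseteq> w" "S4_derives \<Gamma> (foldr Imp ys (Neg \<phi>))"
      by (rule inconsistent_insert)
    then have "set (xs @ ys) \<subseteq> w" "S4_derives \<Gamma> (foldr Imp (xs @ ys) Bot)"
      using that S4_derives_taut_mp2[of \<Gamma> "foldr Imp xs \<phi>" "foldr Imp ys (Neg \<phi>)"
          "foldr Imp (xs @ ys) Bot"]
      by (auto simp: bool_eval_foldr_Imp simp del: foldr_append)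
    then show False using con unfolding consistent_def by blast
  qed
  have "mcs \<Gamma> w"
    unfolding mcs_def
  proof (intro conjI allI impI iffI)
    show "\<phi> \<in> w" if "S4_derives \<Gamma> \<phi>" for \<phi>
      using closed[of "[]"] that by simp
    show "\<psi> \<in> w" if "Imp \<phi> \<psi> \<in> w" "\<phi> \<in> w" for \<phi> \<psi>
      using that
      by (intro closed[of "[Imp \<phi> \<psi>, \<phi>]"]) (auto simp: tautology_def intro: S4_derives.taut)
    show "\<phi> \<notin> w" if "Neg \<phi> \<in> w" for \<phi>
    proof
      assume "\<phi> \<in> w"
      then have "set [Neg \<phi>, \<phi>] \<subseteq> w" using that by simp
      moreover have "S4_derives \<Gamma> (foldr Imp [Neg \<phi>, \<phi>] Bot)"
        by (auto simp: tautology_def intro: S4_derives.taut)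
      ultimately show False using con unfolding consistent_def by blast
    qed
    show "Neg \<phi> \<in> w" if "\<phi> \<notin> w" for \<phi>
      using that ins[of \<phi>] inconsistent_insert[of \<Gamma> \<phi> w] closed by blast
  qed
  then show ?thesis using that \<open>\<Delta> \<subseteq> w\<close> by blast
qed

definition box_part :: "fm set \<Rightarrow> fm set" where
  "box_part w = {\<phi>. Box \<phi> \<in> w}"

lemma box_part_subset: "mcs \<Gamma> w \<Longrightarrow> box_part w \<subseteq> w"
  unfolding box_part_def using mcs_derives[OF _ S4_derives.axT] mcs_mp by blast

text \<open>Axiom 4 turns canonical accessibility into inclusion of box parts. Maximal consistent
  sets with equal box parts thus form a cluster.\<close>

lemma box_part_subset_iff:
  assumes "mcs \<Gamma> w" "mcs \<Gamma> v"
  shows "box_part w \<subseteq> v \<longleftrightarrow> box_part w \<subseteq> box_part v"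
proof
  assume "box_part w \<subseteq> v"
  then show "box_part w \<subseteq> box_part v"
    using assms(1) unfolding box_part_def
    using mcs_derives[OF _ S4_derives.ax4] mcs_mp by blast
next
  assume "box_part w \<subseteq> box_part v"
  then show "box_part w \<subseteq> v" using box_part_subset[OF assms(2)] by blast
qed

lemma S4_derives_Box_foldr_Imp:
  "S4_derives \<Gamma> (Imp (Box (foldr Imp xs \<phi>)) (foldr Imp (map Box xs) (Box \<phi>)))"
proof (induction xs)
  case Nil
  then show ?case by (auto simp: tautology_def intro: S4_derives.taut)
next
  case (Cons a xs)
  show ?case
    by (rule S4_derives_taut_mp2[OF Cons S4_derives.axK[of \<Gamma> a "foldr Imp xs \<phi>"]]) auto
qed

text \<open>The existence lemma of the canonical model: otherwise finitely many formulas of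
  \<open>box_part w\<close> imply \<open>\<phi>\<close>, and boxing this implication puts
  \<open>Box \<phi>\<close> into \<open>w\<close>.\<close>

lemma mcs_not_Box:
  assumes "mcs \<Gamma> w" "Box \<phi> \<notin> w"
  obtains v where "mcs \<Gamma> v" "box_part w \<subseteq> box_part v" "Neg \<phi> \<in> v"
proof -
  have "consistent \<Gamma> (insert (Neg \<phi>) (box_part w))"
  proof (rule ccontr)
    assume "\<not> ?thesis"
    then obtain xs where xs: "set xs \<subseteq> box_part w" "S4_derives \<Gamma> (foldr Imp xs (Neg (Neg \<phi>)))"
      by (rule inconsistent_insert)
    have "S4_derives \<Gamma> (foldr Imp xs \<phi>)"
      by (rule S4_derives_taut_mp[OF xs(2)]) (auto simp: bool_eval_foldr_Imp)
    then have "S4_derives \<Gamma> (foldr Imp (map Box xs) (Box \<phi>))"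
      using S4_derives_Box_foldr_Imp S4_derives.mp S4_derives.nec by blast
    then have "Box \<phi> \<in> w"
      using mcs_foldr_Imp[OF assms(1), of "map Box xs"] mcs_derives[OF assms(1)] xs(1)
      by (auto simp: box_part_def)
    then show False using assms(2) by blast
  qed
  then obtain v where "mcs \<Gamma> v" "insert (Neg \<phi>) (box_part w) \<subseteq> v"
    by (rule mcs_extension)
  then show ?thesis using that box_part_subset_iff[OF assms(1)] by blast
qed

text \<open>Box theories stand for the clusters of the canonical model.\<close>

definition box_theory :: "fm set \<Rightarrow> fm set \<Rightarrow> bool" where
  "box_theory \<Gamma> S \<longleftrightarrow> (\<exists>w. mcs \<Gamma> w \<and> S = box_part w)"

text \<open>Limit stages need this. It is a compactness argument: a finite part of the description
  \<open>\<Delta>\<close> mentions finitely many elements of the union; they lie in one member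
  \<open>S\<close> of the chain, and formulas outside the union lie outside \<open>S\<close> as
  well.\<close>

lemma box_theory_Union:
  assumes "\<C> \<noteq> {}" "subset.chain (Collect (box_theory \<Gamma>)) \<C>"
  shows "box_theory \<Gamma> (\<Union>\<C>)"
proof -
  \<comment> \<open>\<open>\<Delta>\<close> decides every boxed formula, so that any maximal
    consistent extension has exactly the union as its box part.\<close>
  define \<Delta> where "\<Delta> = Box ` (\<Union>\<C>) \<union> (Neg \<circ> Box) ` (- \<Union>\<C>)"
  have "consistent \<Gamma> \<Delta>"
  proof (rule consistent_finite)
    fix \<Delta>' assume fin: "finite \<Delta>'" and sub: "\<Delta>' \<subseteq> \<Delta>"
    have "finite (Box -` \<Delta>')" using fin by (simp add: finite_vimageI inj_def)
    then have "finite (Box -` \<Delta>' \<inter> \<Union>\<C>)" "Box -` \<Delta>' \<inter> \<Union>\<C> \<subseteq> \<Union>\<C>" by auto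
    then obtain S where S: "S \<in> \<C>" "Box -` \<Delta>' \<inter> \<Union>\<C> \<subseteq> S"
      using finite_subset_Union_chain assms by metis
    then obtain w where w: "mcs \<Gamma> w" "S = box_part w"
      using assms(2) unfolding subset.chain_def box_theory_def by blast
    have "\<Delta>' \<subseteq> w"
    proof
      fix \<chi> assume \<chi>: "\<chi> \<in> \<Delta>'"
      then have "\<chi> \<in> Box ` \<Union>\<C> \<union> (Neg \<circ> Box) ` (- \<Union>\<C>)" using sub by (auto simp: \<Delta>_def)
      then consider \<phi> where "\<chi> = Box \<phi>" "\<phi> \<in> \<Union>\<C>" | \<phi> where "\<chi> = Neg (Box \<phi>)" "\<phi> \<notin> \<Union>\<C>"
        by auto
      then show "\<chi> \<in> w"
      proof cases
        case 1
        then have "\<phi> \<in> S" using S \<chi> by auto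
        then show ?thesis using 1 w by (simp add: box_part_def)
      next
        case 2
        then have "\<phi> \<notin> S" using S by auto
        then show ?thesis using 2 w by (simp add: box_part_def mcs_Neg)
      qed
    qed
    then show "consistent \<Gamma> \<Delta>'" using mcs_consistent[OF w(1)] consistent_mono by blast
  qed
  then obtain w where w: "mcs \<Gamma> w" "\<Delta> \<subseteq> w" by (rule mcs_extension)
  have "\<Union>\<C> = box_part w"
    using w by (auto simp: \<Delta>_def box_part_def mcs_Neg[OF w(1)] image_subset_iff)
  then show ?thesis using w unfolding box_theory_def by blast
qed

section \<open>Spaces that split into cells\<close>

text \<open>In other words, every fibre of \<open>l\<close> within \<open>F\<close> is dense in
  \<open>F\<close>.\<close>

definition resolves :: "'a topology \<Rightarrow> 'a set \<Rightarrow> ('a \<Rightarrow> 'b) \<Rightarrow> bool" where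
  "resolves X F l \<longleftrightarrow> (\<forall>x\<in>F. \<forall>U b. openin X U \<longrightarrow> x \<in> U \<longrightarrow> (\<exists>q\<in>U \<inter> F. l q = b))"

text \<open>The remainder \<open>K - \<Union>\<D>\<close> is meant for labels from the current
  cluster, the sets in \<open>\<D>\<close> for larger clusters. As whole sets \<open>D\<close> lie
  in each neighbourhood of a remaining point, whatever is realized somewhere in \<open>D\<close> is
  realized near that point.\<close>

definition splits :: "'a topology \<Rightarrow> 'a set set \<Rightarrow> 'a set \<Rightarrow> 'a set set \<Rightarrow> ('a set \<Rightarrow> 'b) \<Rightarrow> bool" where
  "splits X cells K \<D> c \<longleftrightarrow>
    (\<forall>D\<in>\<D>. D \<in> cells \<and> openin X D \<and> D \<subseteq> K \<and> D \<noteq> {}) \<and>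
    (\<forall>D\<in>\<D>. \<forall>D'\<in>\<D>. D \<noteq> D' \<longrightarrow> D \<inter> D' = {}) \<and>
    (K \<noteq> {} \<longrightarrow> K - \<Union>\<D> \<noteq> {}) \<and>
    (\<forall>x\<in>K - \<Union>\<D>. \<forall>U b. openin X U \<longrightarrow> x \<in> U \<longrightarrow> (\<exists>D\<in>\<D>. D \<subseteq> U \<and> c D = b))"

lemma splitsD:
  "splits X cells K \<D> c \<Longrightarrow> x \<in> K - \<Union>\<D> \<Longrightarrow> openin X U \<Longrightarrow> x \<in> U \<Longrightarrow> \<exists>D\<in>\<D>. D \<subseteq> U \<and> c D = b"
  by (simp add: splits_def)

text \<open>Colours and values are formulas because they act as requests: a part or point marked
  \<open>\<phi>\<close> is to realize \<open>\<phi>\<close> whenever the available clusters allow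
  it. The last axiom serves cells whose cluster has none strictly above it; they are not split
  further.\<close>

locale cell_space =
  fixes X :: "'a topology" and cells :: "'a set set"
  assumes topspace_nonempty: "topspace X \<noteq> {}"
    and topspace_cell: "topspace X \<in> cells"
    and Inter_cells: "M \<noteq> {} \<Longrightarrow> M \<subseteq> cells \<Longrightarrow> countable M \<Longrightarrow> \<Inter>M \<in> cells"
    and cell_splits: "K \<in> cells \<Longrightarrow>
      \<exists>\<D> (c :: 'a set \<Rightarrow> fm) (l :: 'a \<Rightarrow> fm). splits X cells K \<D> c \<and> resolves X (K - \<Union>\<D>) l"
    and cell_resolves: "K \<in> cells \<Longrightarrow> \<exists>l :: 'a \<Rightarrow> fm. resolves X K l"

section \<open>Chains of states\<close>

definition state_leq :: "(('a set \<times> 'b set) \<times> ('a set \<times> 'b set)) set" where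
  "state_leq = {(s, t). fst t \<subseteq> fst s \<and> snd s \<subseteq> snd t}"

definition state_lub :: "('a set \<times> 'b set) set \<Rightarrow> 'a set \<times> 'b set" where
  "state_lub M = (\<Inter>(fst ` M), \<Union>(snd ` M))"

lemma state_leq_iff: "(s, t) \<in> state_leq \<longleftrightarrow> fst t \<subseteq> fst s \<and> snd s \<subseteq> snd t"
  by (simp add: state_leq_def)

lemma state_lub_simps [simp]:
  "fst (state_lub M) = \<Inter>(fst ` M)" "snd (state_lub M) = \<Union>(snd ` M)" "state_lub {s} = s"
  by (auto simp: state_lub_def prod_eq_iff)

lemma Field_state_leq: "Field state_leq = UNIV"
  by (auto simp: Field_def state_leq_def)

lemma Partial_order_state_leq: "Partial_order state_leq"
  unfolding order_on_defs Field_state_leq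
  by (auto simp: state_leq_def refl_on_def prod_eq_iff intro!: transI antisymI)

text \<open>If one state attains the whole union of the second components, it is the last one and
  suffices. Otherwise a state is chosen for each of the countably many elements of the union; any
  given state misses some element, and the state chosen for that element lies beyond it.\<close>

lemma countable_cofinal_substates:
  fixes M :: "('a set \<times> 'b :: countable set) set"
  assumes "M \<in> Chains state_leq" "M \<noteq> {}"
    and inj: "\<And>s t. s \<in> M \<Longrightarrow> t \<in> M \<Longrightarrow> snd s = snd t \<Longrightarrow> s = t"
  obtains M' where "M' \<subseteq> M" "M' \<noteq> {}" "countable M'" "\<Inter>(fst ` M') = \<Inter>(fst ` M)"
proof (cases "\<exists>s\<in>M. snd s = \<Union>(snd ` M)")
  case True
  then obtain s where s: "s \<in> M" "snd s = \<Union>(snd ` M)" by blast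
  have "fst s \<subseteq> fst t" if t: "t \<in> M" for t
  proof -
    have "(s, t) \<in> state_leq \<or> (t, s) \<in> state_leq" using assms s t by (auto dest: in_ChainsD)
    moreover have "snd t \<subseteq> snd s" using s t by auto
    ultimately show ?thesis using inj[OF s(1) t] by (auto simp: state_leq_def)
  qed
  then have "\<Inter>(fst ` {s}) = \<Inter>(fst ` M)" using s by auto
  then show ?thesis using that[of "{s}"] s by auto
next
  case False
  have "\<forall>b\<in>\<Union>(snd ` M). \<exists>s\<in>M. b \<in> snd s" by auto
  then obtain f where f: "\<And>b. b \<in> \<Union>(snd ` M) \<Longrightarrow> f b \<in> M \<and> b \<in> snd (f b)" by metis
  define M' where "M' = f ` (\<Union>(snd ` M))"
  have cofinal: "\<exists>t\<in>M'. fst t \<subseteq> fst s" if s: "s \<in> M" for s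
  proof -
    have "snd s \<noteq> \<Union>(snd ` M)" using False s by auto
    then obtain b where b: "b \<in> \<Union>(snd ` M)" "b \<notin> snd s" using s by auto
    have "(s, f b) \<in> state_leq \<or> (f b, s) \<in> state_leq"
      using assms(1) s f[OF b(1)] by (auto dest: in_ChainsD)
    then have "fst (f b) \<subseteq> fst s" using f[OF b(1)] b(2) by (auto simp: state_leq_def)
    then show ?thesis using b(1) by (auto simp: M'_def)
  qed
  have sub: "M' \<subseteq> M" using f unfolding M'_def by blast
  have "\<Inter>(fst ` M') = \<Inter>(fst ` M)" using cofinal sub by fast
  moreover have "M' \<noteq> {}" using cofinal assms(2) by auto
  moreover have "countable M'" by (simp add: M'_def)
  ultimately show ?thesis using that sub by blast
qed

section \<open>Transfinite labelling from a maximal consistent set\<close>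

locale cell_labelling = cell_space X cells for X :: "'a topology" and cells +
  fixes \<Gamma> :: "fm set" and w\<^sub>0 :: "fm set"
  assumes mcs_root: "mcs \<Gamma> w\<^sub>0"
begin

definition final :: "fm set \<Rightarrow> bool" where
  "final S \<longleftrightarrow> \<not> (\<exists>v. mcs \<Gamma> v \<and> S \<subset> box_part v)"

text \<open>Possibly \<open>\<phi>\<close> occurs in no cluster strictly above \<open>S\<close>; the
  implication then lets the choice fall on any larger box theory, so that a part of any colour can
  be passed on.\<close>

definition raise :: "fm set \<Rightarrow> fm \<Rightarrow> fm set" where
  "raise S \<phi> = (SOME S'. box_theory \<Gamma> S' \<and> S \<subset> S' \<and>
    ((\<exists>v. mcs \<Gamma> v \<and> S \<subset> box_part v \<and> \<phi> \<in> v) \<longrightarrow> (\<exists>v. mcs \<Gamma> v \<and> box_part v = S' \<and> \<phi> \<in> v)))"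

definition witness :: "fm set \<Rightarrow> fm \<Rightarrow> fm set" where
  "witness S \<phi> = (SOME w. mcs \<Gamma> w \<and> box_part w = S \<and>
    ((\<exists>v. mcs \<Gamma> v \<and> box_part v = S \<and> \<phi> \<in> v) \<longrightarrow> \<phi> \<in> w))"

lemma raise:
  assumes "\<not> final S"
  shows "box_theory \<Gamma> (raise S \<phi>) \<and> S \<subset> raise S \<phi> \<and>
    ((\<exists>v. mcs \<Gamma> v \<and> S \<subset> box_part v \<and> \<phi> \<in> v) \<longrightarrow>
      (\<exists>v. mcs \<Gamma> v \<and> box_part v = raise S \<phi> \<and> \<phi> \<in> v))"
proof -
  have "\<exists>S'. box_theory \<Gamma> S' \<and> S \<subset> S' \<and>
    ((\<exists>v. mcs \<Gamma> v \<and> S \<subset> box_part v \<and> \<phi> \<in> v) \<longrightarrow> (\<exists>v. mcs \<Gamma> v \<and> box_part v = S' \<and> \<phi> \<in> v))"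
    using assms unfolding final_def box_theory_def by metis
  then show ?thesis unfolding raise_def by (rule someI_ex)
qed

lemma witness:
  assumes "box_theory \<Gamma> S"
  shows "mcs \<Gamma> (witness S \<phi>) \<and> box_part (witness S \<phi>) = S \<and>
    ((\<exists>v. mcs \<Gamma> v \<and> box_part v = S \<and> \<phi> \<in> v) \<longrightarrow> \<phi> \<in> witness S \<phi>)"
proof -
  have "\<exists>w. mcs \<Gamma> w \<and> box_part w = S \<and>
    ((\<exists>v. mcs \<Gamma> v \<and> box_part v = S \<and> \<phi> \<in> v) \<longrightarrow> \<phi> \<in> w)"
    using assms unfolding box_theory_def by metis
  then show ?thesis unfolding witness_def by (rule someI_ex)
qed

text \<open>The choice depends on \<open>K\<close> only and not on a point, so that points sharing a
  cell are treated alike.\<close>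

definition cell_data :: "'a set \<Rightarrow> 'a set set \<times> ('a set \<Rightarrow> fm) \<times> ('a \<Rightarrow> fm)" where
  "cell_data K = (SOME (\<D>, c, l). splits X cells K \<D> c \<and> resolves X (K - \<Union>\<D>) l)"

definition colour :: "'a set \<Rightarrow> 'a set \<Rightarrow> fm" where
  "colour K = fst (snd (cell_data K))"

definition parts :: "'a set \<times> fm set \<Rightarrow> 'a set set" where
  "parts s = (if fst s \<in> cells \<and> \<not> final (snd s) then fst (cell_data (fst s)) else {})"

definition tag :: "'a set \<times> fm set \<Rightarrow> 'a \<Rightarrow> fm" where
  "tag s = (if final (snd s) then SOME l. resolves X (fst s) l else snd (snd (cell_data (fst s))))"

definition settled :: "'a set \<times> fm set \<Rightarrow> 'a set" where
  "settled s = fst s - \<Union>(parts s)"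

text \<open>A state \<open>(K, S)\<close> records that every point of the cell \<open>K\<close> will get a label whose box part
  contains \<open>S\<close>. Each proper step enlarges \<open>S\<close>, so along the iteration at one point the cells change only
  countably often; this is what keeps the intersections at limit stages among the cells.\<close>

definition advance :: "'a \<Rightarrow> 'a set \<times> fm set \<Rightarrow> 'a set \<times> fm set" where
  "advance x s = (if x \<in> \<Union>(parts s)
    then let D = THE D. D \<in> parts s \<and> x \<in> D in (D, raise (snd s) (colour (fst s) D)) else s)"

lemma cell_data:
  assumes "K \<in> cells"
  shows "splits X cells K (fst (cell_data K)) (colour K)"
    "resolves X (K - \<Union>(fst (cell_data K))) (snd (snd (cell_data K)))"
proof -
  have "case cell_data K of (\<D>, c, l) \<Rightarrow> splits X cells K \<D> c \<and> resolves X (K - \<Union>\<D>) l"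
    unfolding cell_data_def by (rule someI_ex) (use cell_splits[OF assms] in auto)
  then show "splits X cells K (fst (cell_data K)) (colour K)"
    "resolves X (K - \<Union>(fst (cell_data K))) (snd (snd (cell_data K)))"
    by (auto simp: colour_def split: prod.splits)
qed

lemma splits_parts:
  assumes "fst s \<in> cells" "\<not> final (snd s)"
  shows "splits X cells (fst s) (parts s) (colour (fst s))"
  using assms cell_data(1) by (simp add: parts_def)

lemma parts_not_final: "D \<in> parts s \<Longrightarrow> fst s \<in> cells \<and> \<not> final (snd s)"
  by (auto simp: parts_def split: if_splits)

lemma part_cell:
  assumes "D \<in> parts s"
  shows "D \<in> cells" "openin X D" "D \<subseteq> fst s" "D \<noteq> {}"
  using splits_parts[of s] parts_not_final[OF assms] assms by (auto simp: splits_def)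

lemma parts_unique: "D \<in> parts s \<Longrightarrow> D' \<in> parts s \<Longrightarrow> x \<in> D \<Longrightarrow> x \<in> D' \<Longrightarrow> D = D'"
  using splits_parts[of s] parts_not_final[of D s] unfolding splits_def by blast

lemma settled_nonempty:
  assumes "fst s \<in> cells" "fst s \<noteq> {}"
  shows "settled s \<noteq> {}"
proof (cases "final (snd s)")
  case True
  then show ?thesis using assms by (simp add: settled_def parts_def)
next
  case False
  then show ?thesis using splits_parts[of s] assms by (auto simp: splits_def settled_def)
qed

lemma resolves_settled:
  assumes "fst s \<in> cells"
  shows "resolves X (settled s) (tag s)"
proof (cases "final (snd s)")
  case True
  then show ?thesis
    using someI_ex[OF cell_resolves[OF assms]] by (simp add: settled_def parts_def tag_def)
next
  case False
  then show ?thesis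
    using cell_data(2)[OF assms] assms by (simp add: settled_def parts_def tag_def)
qed

lemma advance_part:
  assumes "D \<in> parts s" "x \<in> D"
  shows "advance x s = (D, raise (snd s) (colour (fst s) D))"
proof -
  have "(THE D. D \<in> parts s \<and> x \<in> D) = D"
    using assms parts_unique by (intro the_equality) blast+
  then show ?thesis using assms by (auto simp: advance_def)
qed

lemma advance_cases:
  obtains "advance x s = s" "x \<notin> \<Union>(parts s)"
  | D where "D \<in> parts s" "x \<in> D" "advance x s = (D, raise (snd s) (colour (fst s) D))"
      "snd s \<subset> snd (advance x s)" "fst (advance x s) \<subseteq> fst s" "box_theory \<Gamma> (snd (advance x s))"
proof (cases "x \<in> \<Union>(parts s)")
  case True
  then obtain D where D: "D \<in> parts s" "x \<in> D" by blast
  then show ?thesis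
    using that(2)[OF D advance_part[OF D]] advance_part[OF D] part_cell(3)[OF D(1)]
      raise parts_not_final[OF D(1)] by auto
next
  case False
  then show ?thesis using that(1) by (auto simp: advance_def)
qed

text \<open>A proper step strictly enlarges the second component and so cannot return
  \<open>s\<close>.\<close>

lemma advance_fixed_iff: "advance x s = s \<longleftrightarrow> x \<notin> \<Union>(parts s)"
proof (cases x s rule: advance_cases)
  case (2 D)
  then have "advance x s \<noteq> s" by (metis psubset_eq)
  then show ?thesis using 2 by blast
qed simp

text \<open>The Bourbaki-Witt theorem asks only that \<open>advance x\<close> be inflationary, not
  that it be monotone.\<close>

sublocale bw: bourbaki_witt_fixpoint state_lub state_leq "advance x" for x
proof
  show "Partial_order (state_leq :: (('a set \<times> fm set) \<times> _) set)"
    by (rule Partial_order_state_leq)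
  show "(s, advance x s) \<in> state_leq" for s
    by (cases x s rule: advance_cases) (auto simp: state_leq_iff)
qed (auto simp: state_leq_iff Field_state_leq)

abbreviation root :: "'a set \<times> fm set" where
  "root \<equiv> (topspace X, box_part w\<^sub>0)"

abbreviation stages :: "'a \<Rightarrow> ('a set \<times> fm set) set" where
  "stages x \<equiv> bw.iterates_above x root"

text \<open>Proper steps enlarge the second component, and a limit keeps every enlargement made
  before it.\<close>

lemma iterates_strict:
  assumes "t \<in> bw.iterates_above x s"
  shows "t = s \<or> snd s \<subset> snd t"
  using assms
proof induction
  case (step t)
  then show ?case by (cases x t rule: advance_cases) auto
next
  case (Sup M)
  show ?case
  proof (cases "M \<subseteq> {s}")
    case True
    then have "M = {s}" using Sup(2) by auto
    then show ?thesis by (simp)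
  next
    case False
    then obtain t where "t \<in> M" "snd s \<subset> snd t" using Sup by blast
    then show ?thesis by (auto)
  qed
qed simp

text \<open>Of two stages at one point, one is an iterate of the other, so
  \<open>iterates_strict\<close> separates them.\<close>

lemma stages_inj:
  assumes "s \<in> stages x" "t \<in> stages x" "snd s = snd t"
  shows "s = t"
  using bw.iterates_above_triangle[OF assms(1,2)] iterates_strict[of s x t] iterates_strict[of t x s]
    assms(3) by (auto simp: Field_state_leq)

text \<open>At a limit, distinct stages have distinct second components, so a countable subfamily
  yields the same intersection, which is a cell; the second components are handled by
  \<open>box_theory_Union\<close>.\<close>

lemma stages_valid:
  assumes "s \<in> stages x" "x \<in> topspace X"
  shows "x \<in> fst s \<and> fst s \<in> cells \<and> box_theory \<Gamma> (snd s)"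
  using assms(1)
proof induction
  case base
  then show ?case using assms(2) topspace_cell mcs_root by (auto simp: box_theory_def)
next
  case (step s)
  then show ?case
    using part_cell(1)[of _ s] by (cases x s rule: advance_cases) auto
next
  case (Sup M)
  obtain M' where M': "M' \<subseteq> M" "M' \<noteq> {}" "countable M'" "\<Inter>(fst ` M') = \<Inter>(fst ` M)"
    using countable_cofinal_substates[OF Sup(1,2)] stages_inj[OF Sup(3) Sup(3)] by blast
  have "fst ` M' \<subseteq> cells" using Sup M' by auto
  then have "\<Inter>(fst ` M') \<in> cells" using Inter_cells[of "fst ` M'"] M' by auto
  moreover have "box_theory \<Gamma> (\<Union>(snd ` M))"
  proof (rule box_theory_Union)
    show "subset.chain (Collect (box_theory \<Gamma>)) (snd ` M)"
      unfolding subset.chain_def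
    proof (intro conjI ballI)
      show "snd ` M \<subseteq> Collect (box_theory \<Gamma>)" using Sup by auto
      fix S T assume "S \<in> snd ` M" "T \<in> snd ` M"
      then show "(\<subset>)\<^sup>=\<^sup>= S T \<or> (\<subset>)\<^sup>=\<^sup>= T S"
        using in_ChainsD[OF Sup(1)] by (fastforce simp: state_leq_iff)
    qed
  qed (use Sup in auto)
  ultimately show ?case using Sup M' by (auto)
qed

text \<open>All parts entered by \<open>x\<close> before \<open>s\<close> contain the cell of
  \<open>s\<close>, hence also \<open>y\<close>, which therefore undergoes the same steps.\<close>

lemma stages_transfer:
  assumes "s \<in> stages x" "y \<in> fst s" "x \<in> topspace X"
  shows "s \<in> stages y"
  using assms(1,2)
proof induction
  case base
  show ?case by (rule bw.iterates_above.base)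
next
  case (step s)
  show ?case
  proof (cases x s rule: advance_cases)
    case 1
    then show ?thesis using step by simp
  next
    case (2 D)
    then have "y \<in> D" "s \<in> stages y" using step by auto
    then have "advance y s = advance x s" using 2 advance_part by metis
    then show ?thesis using bw.iterates_above.step[OF \<open>s \<in> stages y\<close>] by simp
  qed
next
  case (Sup M)
  then show ?case by (intro bw.iterates_above.Sup) (auto simp del: split_paired_All)
qed

definition stage :: "'a \<Rightarrow> 'a set \<times> fm set" where
  "stage x = bw.fixp_above x root"

lemma stage_in_stages: "stage x \<in> stages x"
  unfolding stage_def by (rule bw.fixp_iterates_above)

lemma stage_upper: "s \<in> stages x \<Longrightarrow> snd s \<subseteq> snd (stage x)"
proof -
  assume s: "s \<in> stages x"
  have root: "root \<in> Field state_leq" by (simp add: Field_state_leq)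
  show ?thesis
    using bw.lub_upper[OF bw.chain_iterates_above[OF root] s]
    by (simp add: stage_def bw.fixp_above_inside[OF root] state_leq_iff)
qed

lemma settled_stage:
  assumes "x \<in> topspace X"
  shows "x \<in> settled (stage x)"
proof -
  have "advance x (stage x) = stage x"
    unfolding stage_def by (rule bw.fixp_above_unfold[symmetric]) (simp add: Field_state_leq)
  then show ?thesis
    using stages_valid[OF stage_in_stages assms] by (simp add: advance_fixed_iff settled_def)
qed

lemma iterates_fixed:
  assumes "t \<in> bw.iterates_above x s" "advance x s = s"
  shows "t = s"
  using assms(1)
proof induction
  case (Sup M)
  then have "M = {s}" by auto
  then show ?case by (simp)
qed (auto simp: assms(2))

text \<open>A settled state is a fixed point that the iteration cannot leave, and of two stages one
  is an iterate of the other.\<close>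

lemma stage_eqI:
  assumes "s \<in> stages x" "x \<in> topspace X" "x \<in> settled s"
  shows "stage x = s"
proof -
  have "advance x s = s" using assms by (simp add: advance_fixed_iff settled_def)
  moreover have "advance x (stage x) = stage x"
    using settled_stage[OF assms(2)] by (simp add: advance_fixed_iff settled_def)
  ultimately show ?thesis
    using bw.iterates_above_triangle[OF assms(1) stage_in_stages]
      iterates_fixed[of s x "stage x"] iterates_fixed[of "stage x" x s]
    by (auto simp: Field_state_leq)
qed

section \<open>Labels and the truth lemma\<close>

definition label :: "'a \<Rightarrow> fm set" where
  "label x = witness (snd (stage x)) (tag (stage x) x)"

lemma label:
  assumes "x \<in> topspace X"
  shows "mcs \<Gamma> (label x)" "box_part (label x) = snd (stage x)"
  using stages_valid[OF stage_in_stages assms] witness by (auto simp: label_def)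

text \<open>Density of the fibres of \<open>tag s\<close> provides a settled \<open>q\<close> in
  \<open>U\<close> with tag \<open>\<phi>\<close>. Its iteration ends at \<open>s\<close> as well,
  and \<open>witness\<close> grants \<open>\<phi>\<close> because \<open>v\<close> shows that the
  cluster allows it.\<close>

lemma label_realizes:
  assumes s: "s \<in> stages x" and x: "x \<in> topspace X"
    and y: "y \<in> settled s" and U: "openin X U" "y \<in> U"
    and v: "mcs \<Gamma> v" "box_part v = snd s" "\<phi> \<in> v"
  shows "\<exists>q\<in>U. q \<in> settled s \<and> \<phi> \<in> label q"
proof -
  have cell: "fst s \<in> cells" "box_theory \<Gamma> (snd s)" using stages_valid[OF s x] by auto
  then obtain q where q: "q \<in> U" "q \<in> settled s" "tag s q = \<phi>"
    using resolves_settled[OF cell(1)] y U unfolding resolves_def by blast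
  have "q \<in> fst s" "q \<in> topspace X" using q U openin_subset by (auto simp: settled_def)
  then have "stage q = s" using stage_eqI stages_transfer[OF s] q x by blast
  then have "label q = witness (snd s) \<phi>" using q by (simp add: label_def)
  then show ?thesis using witness[OF cell(2)] v q by auto
qed

text \<open>Limit cells need not be open, but a formula in a union was present before the limit. The
  induction thus falls back on the root and on proper steps, whose cells are open.\<close>

lemma stages_open:
  assumes "s \<in> stages x" "\<phi> \<in> snd s"
  shows "\<exists>t\<in>stages x. openin X (fst t) \<and> \<phi> \<in> snd t"
  using assms
proof induction
  case base
  then show ?case using bw.iterates_above.base by (intro bexI[of _ root]) auto
next
  case (step s)
  show ?case
  proof (cases x s rule: advance_cases)
    case 1
    then show ?thesis using step by simp
  next
    case (2 D)
    then show ?thesis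
      using bw.iterates_above.step[OF step(1)] part_cell(2)[OF 2(1)] step(3)
      by (intro bexI[of _ "advance x s"]) auto
  qed
next
  case (Sup M)
  then obtain s where "s \<in> M" "\<phi> \<in> snd s" by (auto)
  then show ?case using Sup by blast
qed

text \<open>If the box is in the label, \<open>\<phi>\<close> was recorded at a stage with an open
  cell and is kept by all points of that cell. If not, the canonical model supplies a
  \<open>v\<close> with \<open>Neg \<phi>\<close>, and every neighbourhood contains a point
  realizing \<open>Neg \<phi>\<close>.\<close>

lemma label_Box:
  assumes x: "x \<in> topspace X"
  shows "Box \<phi> \<in> label x \<longleftrightarrow> (\<exists>U. openin X U \<and> x \<in> U \<and> (\<forall>y\<in>U. \<phi> \<in> label y))"
proof
  assume "Box \<phi> \<in> label x"
  then have "\<phi> \<in> snd (stage x)" using label(2)[OF x] by (auto simp: box_part_def)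
  then obtain t where t: "t \<in> stages x" "openin X (fst t)" "\<phi> \<in> snd t"
    using stages_open[OF stage_in_stages] by blast
  have "\<phi> \<in> label y" if y: "y \<in> fst t" for y
  proof -
    have "y \<in> topspace X" using t y openin_subset by blast
    moreover have "\<phi> \<in> snd (stage y)"
      using stage_upper stages_transfer[OF t(1) y x] t(3) by blast
    ultimately show ?thesis using label[of y] box_part_subset[of \<Gamma> "label y"] by blast
  qed
  then show "\<exists>U. openin X U \<and> x \<in> U \<and> (\<forall>y\<in>U. \<phi> \<in> label y)"
    using t(2) stages_valid[OF t(1) x] by (intro exI[of _ "fst t"]) simp
next
  assume "\<exists>U. openin X U \<and> x \<in> U \<and> (\<forall>y\<in>U. \<phi> \<in> label y)"
  then obtain U where U: "openin X U" "x \<in> U" "\<forall>y\<in>U. \<phi> \<in> label y" by blast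
  show "Box \<phi> \<in> label x"
  proof (rule ccontr)
    define s where "s = stage x"
    have s: "s \<in> stages x" "x \<in> settled s" "fst s \<in> cells"
      using stage_in_stages settled_stage[OF x] stages_valid[OF stage_in_stages x]
      by (auto simp: s_def)
    assume "Box \<phi> \<notin> label x"
    then obtain v where v: "mcs \<Gamma> v" "snd s \<subseteq> box_part v" "Neg \<phi> \<in> v"
      by (rule mcs_not_Box[OF label(1)[OF x]]) (simp add: label(2)[OF x] s_def)
    \<comment> \<open>If \<open>v\<close> is in the cluster of \<open>x\<close>, a settled point
      near \<open>x\<close> serves; if \<open>v\<close> lies strictly above, a part of colour
      \<open>Neg \<phi>\<close> inside \<open>U\<close> does.\<close>
    have "\<exists>q\<in>U. Neg \<phi> \<in> label q"
    proof (cases "box_part v = snd s")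
      case True
      then show ?thesis using label_realizes[OF s(1) x s(2) U(1,2) v(1) True v(3)] by blast
    next
      case False
      then have strict: "snd s \<subset> box_part v" using v(2) by blast
      then have nf: "\<not> final (snd s)" using v(1) unfolding final_def by blast
      then obtain D where D: "D \<in> parts s" "D \<subseteq> U" "colour (fst s) D = Neg \<phi>"
        using splitsD[OF splits_parts[OF s(3) nf] _ U(1,2)] s(2) unfolding settled_def by metis
      define t where "t = (D, raise (snd s) (Neg \<phi>))"
      have "D \<noteq> {}" "D \<in> cells" "openin X D" using part_cell D by auto
      \<comment> \<open>A point of \<open>D\<close> is wanted that stops at \<open>t\<close>:
        further on, the clusters may no longer contain \<open>Neg \<phi>\<close>.\<close>
      then have "settled t \<noteq> {}" by (intro settled_nonempty) (simp_all add: t_def)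
      then obtain y where y: "y \<in> settled t" by blast
      then have "y \<in> D" by (simp add: settled_def t_def)
      then have ytop: "y \<in> topspace X" using \<open>openin X D\<close> openin_subset by blast
      have "s \<in> stages y"
        using stages_transfer[OF s(1) _ x] part_cell(3)[OF D(1)] \<open>y \<in> D\<close> by blast
      then have t: "t \<in> stages y"
        using bw.iterates_above.step[of s y root] advance_part[OF D(1) \<open>y \<in> D\<close>] D(3)
        by (simp add: t_def)
      have "\<exists>v'. mcs \<Gamma> v' \<and> box_part v' = raise (snd s) (Neg \<phi>) \<and> Neg \<phi> \<in> v'"
        using raise[OF nf, of "Neg \<phi>"] v(1,3) strict by blast
      then obtain v' where "mcs \<Gamma> v'" "box_part v' = snd t" "Neg \<phi> \<in> v'"
        by (auto simp: t_def)
      then show ?thesis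
        using label_realizes[OF t ytop y \<open>openin X D\<close> \<open>y \<in> D\<close>] D(2) by blast
    qed
    then obtain q where "q \<in> U" "Neg \<phi> \<in> label q" by blast
    moreover have "q \<in> topspace X" using U(1) \<open>q \<in> U\<close> openin_subset by blast
    ultimately show False using U(3) mcs_Neg[OF label(1), of q \<phi>] by simp
  qed
qed

lemma forces_label:
  assumes "x \<in> topspace X"
  shows "forces X (\<lambda>p. {y \<in> topspace X. Var p \<in> label y}) x \<phi> \<longleftrightarrow> \<phi> \<in> label x"
  using assms
proof (induction \<phi> arbitrary: x)
  case (Box \<phi>)
  have "(\<forall>y\<in>U. forces X (\<lambda>p. {y \<in> topspace X. Var p \<in> label y}) y \<phi>) \<longleftrightarrow> (\<forall>y\<in>U. \<phi> \<in> label y)"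
    if "openin X U" for U
    using Box.IH openin_subset[OF that] by blast
  then show ?case
    unfolding forces.simps label_Box[OF Box(2)] by blast
qed (simp_all add: mcs_Bot[OF label(1)] mcs_Neg[OF label(1)] mcs_And[OF label(1)]
    mcs_Or[OF label(1)] mcs_Imp[OF label(1)])

text \<open>The settled points of the root receive labels from the cluster of
  \<open>w\<^sub>0\<close>, and \<open>w\<^sub>0\<close> shows that this cluster can realize
  \<open>\<phi>\<close>.\<close>

lemma root_label:
  assumes "\<phi> \<in> w\<^sub>0"
  shows "\<exists>q\<in>topspace X. \<phi> \<in> label q"
proof -
  obtain y where y: "y \<in> settled root"
    using settled_nonempty[of root] topspace_cell topspace_nonempty by auto
  then have "y \<in> topspace X" by (simp add: settled_def)
  then show ?thesis
    using label_realizes[OF bw.iterates_above.base _ y openin_topspace _ mcs_root _ assms] by auto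
qed

end

text \<open>Every label contains \<open>\<Gamma>\<close>, so the valuation read off from the labels
  validates \<open>\<Gamma>\<close>, while some label contains \<open>Neg \<phi>\<close>.\<close>

theorem (in cell_space) S4_strongly_complete:
  assumes "models_space X \<Gamma> \<phi>"
  shows "S4_derives \<Gamma> \<phi>"
proof (rule ccontr)
  assume not: "\<not> S4_derives \<Gamma> \<phi>"
  have "consistent \<Gamma> {Neg \<phi>}"
  proof (rule ccontr)
    assume "\<not> consistent \<Gamma> {Neg \<phi>}"
    then obtain xs where "set xs \<subseteq> {}" "S4_derives \<Gamma> (foldr Imp xs (Neg (Neg \<phi>)))"
      by (rule inconsistent_insert)
    then have "S4_derives \<Gamma> (Neg (Neg \<phi>))" by simp
    then have "S4_derives \<Gamma> \<phi>" by (rule S4_derives_taut_mp) simp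
    then show False using not by blast
  qed
  then obtain w where w: "mcs \<Gamma> w" "Neg \<phi> \<in> w" by (auto elim: mcs_extension)
  then interpret cell_labelling X cells \<Gamma> w by unfold_locales
  define V where "V = (\<lambda>p. {y \<in> topspace X. Var p \<in> label y})"
  have forces: "forces X V x \<psi> \<longleftrightarrow> \<psi> \<in> label x" if "x \<in> topspace X" for x \<psi>
    using forces_label[OF that] by (simp add: V_def)
  have "valuation_on X V" by (auto simp: valuation_on_def V_def)
  moreover have "\<forall>\<gamma>\<in>\<Gamma>. validates X V \<gamma>"
    using forces mcs_derives[OF label(1) S4_derives.assm] by (simp add: validates_def)
  ultimately have "validates X V \<phi>" using assms by (simp add: models_space_def)
  then have "\<phi> \<in> label q" if "q \<in> topspace X" for q using forces that by (simp add: validates_def)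
  moreover obtain q where "q \<in> topspace X" "Neg \<phi> \<in> label q" using root_label[OF w(2)] by blast
  ultimately show False using mcs_Neg[OF label(1)] by blast
qed

section \<open>Transfinite selection\<close>

text \<open>Transfinite recursion along a well-order of \<open>I\<close> of least length: fewer than
  \<open>|I|\<close> values are taken before \<open>i\<close>, too few to exhaust
  \<open>S i\<close>.\<close>

lemma injective_selection:
  fixes S :: "'i \<Rightarrow> 'a set"
  assumes large: "\<And>i. i \<in> I \<Longrightarrow> |I| \<le>o |S i|"
  obtains g where "inj_on g I" "\<And>i. i \<in> I \<Longrightarrow> g i \<in> S i"
proof -
  define r where "r = |I|"
  have card: "Card_order r" and Field: "Field r = I"
    by (simp_all add: r_def card_of_Card_order Field_card_of card_of_card_order_on)
  then have wo: "Well_order r" by (simp add: card_order_on_def)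
  then have wf: "wf (r - Id)" by (simp add: well_order_on_def)
  define F where "F = (\<lambda>f i. SOME x. x \<in> S i - f ` underS r i)"
  define g where "g = wfrec (r - Id) F"
  have under: "j \<in> underS r i \<longleftrightarrow> (j, i) \<in> r - Id" for i j by (auto simp: underS_def)
  have g: "g i \<in> S i - g ` underS r i" if "i \<in> I" for i
  proof -
    have "g i = F (cut g (r - Id) i) i"
      unfolding g_def by (rule wfrec[OF wf])
    moreover have "cut g (r - Id) i ` underS r i = g ` underS r i"
      by (intro image_cong refl) (simp add: cut_apply under)
    ultimately have "g i = (SOME x. x \<in> S i - g ` underS r i)" by (simp add: F_def)
    moreover have "\<exists>x. x \<in> S i - g ` underS r i"
    proof (rule ccontr)
      assume "\<not> ?thesis"
      then have "S i \<subseteq> g ` underS r i" by blast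
      then have "|S i| \<le>o |underS r i|"
        using card_of_mono1 card_of_image ordLeq_transitive by blast
      then have "r \<le>o |underS r i|"
        using large[OF that] ordLeq_transitive unfolding r_def by blast
      moreover have "|underS r i| <o r"
        using card_of_underS[OF card] that Field by blast
      ultimately show False using not_ordLess_ordLeq by blast
    qed
    ultimately show ?thesis by (metis someI_ex)
  qed
  have "inj_on g I"
  proof (rule inj_onI)
    fix i j assume ij: "i \<in> I" "j \<in> I" "g i = g j"
    show "i = j"
    proof (rule ccontr)
      assume "i \<noteq> j"
      then have "(i, j) \<in> r - Id \<or> (j, i) \<in> r - Id"
        using wo ij Field by (auto simp: order_on_defs total_on_def)
      then have "i \<in> underS r j \<or> j \<in> underS r i" by (simp add: under)
      then show False using g[OF ij(1)] g[OF ij(2)] ij(3) by (metis DiffE imageI)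
    qed
  qed
  then show ?thesis using that g by blast
qed

text \<open>Distinct elements are reserved for all pairs of a good \<open>Y\<close> and a colour
  \<open>k\<close>; there are at most continuum many pairs. A reserved element gets the colour of
  its pair.\<close>

lemma colouring_exists:
  fixes T :: "nat set \<Rightarrow> 'a set"
  assumes "\<And>Y. good Y \<Longrightarrow> |UNIV :: nat set set| \<le>o |T Y|"
  obtains c :: "'a \<Rightarrow> 'c :: countable" where "\<And>Y k. good Y \<Longrightarrow> \<exists>x\<in>T Y. c x = k"
proof -
  \<comment> \<open>The even numbers code \<open>Y\<close> and the single odd number codes
    \<open>k\<close>; this bounds the number of pairs.\<close>
  define e :: "nat set \<times> 'c \<Rightarrow> nat set"
    where "e = (\<lambda>(Y, k). (\<lambda>y. 2 * y) ` Y \<union> {2 * to_nat k + 1})"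
  have "Y = {y. 2 * y \<in> e (Y, k)}" for Y k
  proof -
    have "2 * x \<noteq> Suc (2 * to_nat k)" for x by presburger
    then show ?thesis by (auto simp: e_def)
  qed
  moreover have "to_nat k = (THE n. 2 * n + 1 \<in> e (Y, k))" for Y k
  proof -
    have "Suc (2 * x) \<noteq> 2 * y" for x y :: nat by presburger
    then show ?thesis by (intro the_equality[symmetric]) (auto simp: e_def)
  qed
  ultimately have "Y = Y'" "to_nat k = to_nat k'" if "e (Y, k) = e (Y', k')" for Y Y' k k'
    using that by metis+
  then have "inj e" by (auto simp: inj_def)
  define I where "I = {Y. good Y} \<times> (UNIV :: 'c set)"
  have "|I| \<le>o |UNIV :: nat set set|"
    using card_of_ordLeqI[of e I UNIV] \<open>inj e\<close> inj_on_subset by blast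
  then have "|I| \<le>o |T (fst i)|" if "i \<in> I" for i
    using ordLeq_transitive[OF _ assms[of "fst i"]] that by (auto simp: I_def)
  then obtain g where g: "inj_on g I" "\<And>i. i \<in> I \<Longrightarrow> g i \<in> T (fst i)"
    using injective_selection[of I "\<lambda>i. T (fst i)"] by blast
  show ?thesis
  proof
    fix Y and k :: 'c assume "good Y"
    then have i: "(Y, k) \<in> I" by (simp add: I_def)
    then have "(snd \<circ> inv_into I g) (g (Y, k)) = k" using g(1) by simp
    then show "\<exists>x\<in>T Y. (snd \<circ> inv_into I g) x = k" using g(2)[OF i] by auto
  qed
qed

section \<open>Almost disjoint sets and partitions of the natural numbers\<close>

lemma continuum_almost_disjoint:
  obtains C :: "nat set \<Rightarrow> nat set"
  where "\<And>a. infinite (C a)" "\<And>a b. a \<noteq> b \<Longrightarrow> finite (C a \<inter> C b)"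
proof
  \<comment> \<open>\<open>C a\<close> consists of the codes of the initial segments of
    \<open>a\<close>, that is, of the branch of \<open>a\<close> in the binary tree.\<close>
  define C where "C = (\<lambda>a. range (\<lambda>n. prod_encode (n, set_encode (a \<inter> {..<n}))))"
  fix a b :: "nat set"
  show "infinite (C a)"
    unfolding C_def by (rule range_inj_infinite) (auto simp: inj_def prod_encode_eq)
  assume "a \<noteq> b"
  then obtain k where k: "k \<in> a \<longleftrightarrow> k \<notin> b" by blast
  \<comment> \<open>Initial segments longer than \<open>k\<close> already disagree at
    \<open>k\<close>.\<close>
  have "C a \<inter> C b \<subseteq> (\<lambda>n. prod_encode (n, set_encode (a \<inter> {..<n}))) ` {..k}"
  proof
    fix x assume "x \<in> C a \<inter> C b"
    then obtain n where n: "x = prod_encode (n, set_encode (a \<inter> {..<n}))"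
      "x = prod_encode (n, set_encode (b \<inter> {..<n}))"
      by (auto simp: C_def prod_encode_eq)
    then have "set_encode (a \<inter> {..<n}) = set_encode (b \<inter> {..<n})" by (simp add: prod_encode_eq)
    then have "a \<inter> {..<n} = b \<inter> {..<n}"
      using inj_on_set_encode by (auto dest!: inj_onD)
    then have "n \<le> k" using k by (metis IntD1 IntI lessThan_iff not_le)
    then show "x \<in> (\<lambda>n. prod_encode (n, set_encode (a \<inter> {..<n}))) ` {..k}" using n by blast
  qed
  then show "finite (C a \<inter> C b)" using finite_subset by blast
qed

lemma set_ideal_finite_Union:
  assumes "set_ideal J" "finite N" "\<And>n. n \<in> N \<Longrightarrow> P n \<in> J"
  shows "(\<Union>n\<in>N. P n) \<in> J"
  using assms(2,3) by (induction N) (use assms(1) in \<open>auto simp: set_ideal_def\<close>)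

text \<open>Pieces are united along almost disjoint index sets. As the pieces are disjoint, two such
  unions meet exactly in the finitely many pieces with common index.\<close>

lemma continuum_positive_subsets:
  fixes P :: "nat \<Rightarrow> 'a set"
  assumes "disjoint_family P"
  obtains Z :: "nat set \<Rightarrow> 'a set"
  where "\<And>a. \<exists>N. infinite N \<and> Z a = (\<Union>n\<in>N. P n)"
    "\<And>a b. a \<noteq> b \<Longrightarrow> \<exists>N. finite N \<and> Z a \<inter> Z b = (\<Union>n\<in>N. P n)"
proof -
  obtain C :: "nat set \<Rightarrow> nat set"
    where C: "\<And>a. infinite (C a)" "\<And>a b. a \<noteq> b \<Longrightarrow> finite (C a \<inter> C b)"
    by (rule continuum_almost_disjoint) blast
  have "(\<Union>n\<in>C a. P n) \<inter> (\<Union>n\<in>C b. P n) = (\<Union>n\<in>C a \<inter> C b. P n)" for a b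
    using disjoint_family_onD[OF assms] by (auto, metis IntI UNIV_I empty_iff)
  moreover have "\<exists>N. infinite N \<and> (\<Union>n\<in>C a. P n) = (\<Union>n\<in>N. P n)" for a
    using C(1) by (intro exI[of _ "C a"]) simp
  moreover have "\<exists>N. finite N \<and> (\<Union>n\<in>C a \<inter> C b. P n) = (\<Union>n\<in>N. P n)" if "a \<noteq> b" for a b
    using C(2)[OF that] by (intro exI[of _ "C a \<inter> C b"]) simp
  ultimately show ?thesis by (intro that[of "\<lambda>a. \<Union>n\<in>C a. P n"]) simp_all
qed

lemma infinite_half:
  fixes A :: "nat set"
  assumes "infinite A"
  obtains B where "B \<subseteq> A" "infinite B" "infinite (A - B)"
proof -
  have bij: "bij_betw (enumerate A) UNIV A" using assms by (rule bij_enumerate)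
  then have inj: "inj (enumerate A)" by (simp add: bij_betw_def)
  have even: "infinite {n :: nat. even n}" and odd: "infinite {n :: nat. odd n}"
    unfolding infinite_nat_iff_unbounded_le mem_Collect_eq by presburger+
  show ?thesis
  proof
    show "enumerate A ` {n. even n} \<subseteq> A" using bij by (auto simp: bij_betw_def)
    show "infinite (enumerate A ` {n. even n})"
      using even inj finite_imageD inj_on_subset by blast
    have "enumerate A ` {n. odd n} \<subseteq> A - enumerate A ` {n. even n}"
      using bij inj by (auto simp: bij_betw_def dest: injD)
    then show "infinite (A - enumerate A ` {n. even n})"
      using odd inj finite_imageD inj_on_subset finite_subset by (metis subset_UNIV)
  qed
qed

lemma bij_betw_infinite_nat:
  fixes A B :: "nat set"
  assumes "infinite A" "infinite B"
  shows "\<exists>f. bij_betw f A B"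
  using bij_betw_trans[OF bij_betw_inv_into[OF bij_enumerate[OF assms(1)]] bij_enumerate[OF assms(2)]]
  by blast

text \<open>Bijections between corresponding pieces are glued; disjointness of the
  \<open>Q i\<close> keeps the result injective.\<close>

lemma match_partitions:
  fixes P Q :: "nat \<Rightarrow> nat set"
  assumes "disjoint_family P" "disjoint_family Q" "\<And>i. infinite (P i)" "\<And>i. infinite (Q i)"
    "(\<Union>i. P i) = UNIV"
  obtains h where "inj h" "\<And>i. h ` P i = Q i"
proof -
  obtain f where f: "\<And>i. bij_betw (f i) (P i) (Q i)"
    using choice[of "\<lambda>i f. bij_betw f (P i) (Q i)"] bij_betw_infinite_nat[OF assms(3,4)] by blast
  have "\<forall>x. \<exists>i. x \<in> P i" using assms(5) by blast
  then obtain k where k: "\<And>x. x \<in> P (k x)" by metis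
  have k_eq: "k x = i" if "x \<in> P i" for x i
    using that k[of x] assms(1) by (auto simp: disjoint_family_on_def)
  define h where "h = (\<lambda>x. f (k x) x)"
  have hP: "h x = f i x" if "x \<in> P i" for x i using k_eq[OF that] by (simp add: h_def)
  have img: "h ` P i = Q i" for i
    using f[of i] hP by (auto simp: bij_betw_def image_def)
  have "inj h"
  proof (rule injI)
    fix x y assume eq: "h x = h y"
    have "h x \<in> Q (k x)" "h y \<in> Q (k y)" using k img by blast+
    then have "k x = k y" using eq assms(2) by (auto simp: disjoint_family_on_def)
    then show "x = y" using eq f[of "k x"] k[of x] k[of y]
      by (auto simp: h_def bij_betw_def dest: inj_onD)
  qed
  then show ?thesis using that img by blast
qed

section \<open>Ultrafilters\<close>

lemma ultrafilter_Compl: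
  "ultrafilter p \<Longrightarrow> eventually (\<lambda>n. n \<notin> A) p \<longleftrightarrow> \<not> eventually (\<lambda>n. n \<in> A) p"
proof -
  assume p: "ultrafilter p"
  have "\<not> (eventually (\<lambda>n. n \<in> A) p \<and> eventually (\<lambda>n. n \<notin> A) p)"
  proof
    assume "eventually (\<lambda>n. n \<in> A) p \<and> eventually (\<lambda>n. n \<notin> A) p"
    then have "eventually (\<lambda>n. False) p" by (auto elim: eventually_elim2)
    then show False using p by (simp add: ultrafilter_def eventually_False)
  qed
  then show ?thesis using p unfolding ultrafilter_def by blast
qed

lemma ultrafilter_Un:
  assumes "ultrafilter p"
  shows "eventually (\<lambda>n. n \<in> A \<union> B) p \<longleftrightarrow> eventually (\<lambda>n. n \<in> A) p \<or> eventually (\<lambda>n. n \<in> B) p"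
proof -
  have "eventually (\<lambda>n. n \<notin> A \<union> B) p \<longleftrightarrow>
      eventually (\<lambda>n. n \<notin> A) p \<and> eventually (\<lambda>n. n \<notin> B) p"
    by (simp add: eventually_conj_iff)
  then show ?thesis
    using ultrafilter_Compl[OF assms, of A] ultrafilter_Compl[OF assms, of B]
      ultrafilter_Compl[OF assms, of "A \<union> B"] by blast
qed

lemma ultrafilter_UN:
  assumes "ultrafilter p" "finite N"
  shows "eventually (\<lambda>n. n \<in> (\<Union>i\<in>N. A i)) p \<longleftrightarrow> (\<exists>i\<in>N. eventually (\<lambda>n. n \<in> A i) p)"
  using assms(2)
proof induction
  case empty
  then show ?case using assms(1) by (simp add: ultrafilter_def eventually_False)
next
  case (insert i N)
  then show ?case using ultrafilter_Un[OF assms(1), of "A i" "\<Union>i\<in>N. A i"] by simp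
qed

lemma ultrafilter_principal_iff:
  assumes "ultrafilter p"
  shows "p = principal {n} \<longleftrightarrow> eventually (\<lambda>m. m \<in> {n}) p"
proof
  show "eventually (\<lambda>m. m \<in> {n}) p" if "p = principal {n}"
    using that by (simp add: eventually_principal)
  assume n: "eventually (\<lambda>m. m \<in> {n}) p"
  have "eventually P p \<longleftrightarrow> P n" for P
  proof
    assume "eventually P p"
    then have "eventually (\<lambda>m. P n) p" using n by eventually_elim simp
    then show "P n" using assms by (cases "P n") (simp_all add: ultrafilter_def eventually_False)
  next
    assume "P n"
    then show "eventually P p" using n by (auto elim: eventually_mono)
  qed
  then show "p = principal {n}" by (simp add: filter_eq_iff eventually_principal)
qed

text \<open>An ideal maximal among those containing \<open>J\<close> and omitting \<open>Y\<close>
  is prime; the sets outside it form the ultrafilter.\<close>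

lemma ultrafilter_avoiding_ideal:
  assumes J: "set_ideal J" and Y: "Y \<notin> J"
  obtains p where "ultrafilter p" "eventually (\<lambda>n. n \<in> Y) p"
    "\<And>Z. Z \<in> J \<Longrightarrow> \<not> eventually (\<lambda>n. n \<in> Z) p"
proof -
  define Q where "Q = {M. set_ideal M \<and> J \<subseteq> M \<and> Y \<notin> M}"
  have chain: "\<Union>C \<in> Q" if C: "C \<noteq> {}" "subset.chain Q C" for C
  proof -
    have CQ: "set_ideal M" "J \<subseteq> M" "Y \<notin> M" if "M \<in> C" for M
      using that C by (auto simp: Q_def subset.chain_def)
    have "set_ideal (\<Union>C)"
      unfolding set_ideal_def
    proof (intro conjI ballI allI impI)
      show "{} \<in> \<Union>C" using C(1) CQ(1) by (auto simp: set_ideal_def)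
      show "B \<in> \<Union>C" if A: "A \<in> \<Union>C" and B: "B \<subseteq> A" for A B
      proof -
        obtain M where "M \<in> C" "A \<in> M" using A by blast
        then have "B \<in> M" using CQ(1)[of M] B by (simp add: set_ideal_def)
        then show ?thesis using \<open>M \<in> C\<close> by blast
      qed
      show "A \<union> B \<in> \<Union>C" if AB: "A \<in> \<Union>C" "B \<in> \<Union>C" for A B
      proof -
        obtain M where "M \<in> C" "A \<in> M" "B \<in> M"
          using AB C(2) unfolding subset_chain_def by blast
        then show ?thesis using CQ(1)[of M] by (auto simp: set_ideal_def)
      qed
    qed
    moreover have "J \<subseteq> \<Union>C" using C(1) CQ(2) by blast
    ultimately show ?thesis using CQ(3) by (auto simp: Q_def)
  qed
  have "Q \<noteq> {}" using J Y by (auto simp: Q_def)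
  then obtain M where "M \<in> Q" and max: "\<And>M'. M' \<in> Q \<Longrightarrow> M \<subseteq> M' \<Longrightarrow> M' = M"
    using subset_Zorn_nonempty[of Q] chain by metis
  then have M: "set_ideal M" "J \<subseteq> M" "Y \<notin> M" by (auto simp: Q_def)
  have M0: "{} \<in> M" and Mmono: "\<And>A B. A \<in> M \<Longrightarrow> B \<subseteq> A \<Longrightarrow> B \<in> M"
    and MUn: "\<And>A B. A \<in> M \<Longrightarrow> B \<in> M \<Longrightarrow> A \<union> B \<in> M"
    using M(1) by (simp_all add: set_ideal_def)
  \<comment> \<open>By maximality, the ideal generated by \<open>M\<close> and \<open>A\<close> has
    to contain \<open>Y\<close>.\<close>
  have cover: "\<exists>m\<in>M. Y \<subseteq> m \<union> A" if A: "A \<notin> M" for A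
  proof (rule ccontr)
    assume no: "\<not> ?thesis"
    define M' where "M' = {B. \<exists>m\<in>M. B \<subseteq> m \<union> A}"
    have "set_ideal M'"
      unfolding set_ideal_def
    proof (intro conjI ballI allI impI)
      show "{} \<in> M'" using M0 by (auto simp: M'_def)
      show "C \<in> M'" if "B \<in> M'" "C \<subseteq> B" for B C
        using that(1) order_trans[OF that(2)] by (auto simp: M'_def)
      show "B \<union> C \<in> M'" if BC: "B \<in> M'" "C \<in> M'" for B C
      proof -
        obtain m m' where "m \<in> M" "m' \<in> M" "B \<subseteq> m \<union> A" "C \<subseteq> m' \<union> A"
          using BC by (auto simp: M'_def)
        then have "m \<union> m' \<in> M" "B \<union> C \<subseteq> (m \<union> m') \<union> A" using MUn by auto
        then show ?thesis unfolding M'_def mem_Collect_eq by (rule bexI[rotated])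
      qed
    qed
    moreover have "M \<subseteq> M'" by (auto simp: M'_def)
    moreover have "Y \<notin> M'" using no by (simp add: M'_def)
    ultimately have "M' = M" using max[of M'] M(2) by (simp add: Q_def)
    moreover have "A \<in> M'" using M0 by (auto simp: M'_def)
    ultimately show False using A by blast
  qed
  have prime: "A \<in> M \<longleftrightarrow> - A \<notin> M" for A
  proof
    assume "A \<in> M"
    show "- A \<notin> M"
    proof
      assume "- A \<in> M"
      then have "A \<union> - A \<in> M" using \<open>A \<in> M\<close> MUn by blast
      then show False using Mmono[of "A \<union> - A" Y] M(3) by simp
    qed
  next
    assume "- A \<notin> M"
    show "A \<in> M"
    proof (rule ccontr)
      assume "A \<notin> M"
      then obtain m m' where "m \<in> M" "m' \<in> M" "Y \<subseteq> m \<union> A" "Y \<subseteq> m' \<union> - A"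
        using cover[OF \<open>A \<notin> M\<close>] cover[OF \<open>- A \<notin> M\<close>] by blast
      then have "m \<union> m' \<in> M" "Y \<subseteq> m \<union> m'" using MUn by auto
      then show False using Mmono[of "m \<union> m'" Y] M(3) by blast
    qed
  qed
  define p where "p = Abs_filter (\<lambda>P. {n. \<not> P n} \<in> M)"
  have "is_filter (\<lambda>P. {n. \<not> P n} \<in> M)"
  proof
    show "{n. \<not> True} \<in> M" using M0 by simp
    show "{n. \<not> (P n \<and> R n)} \<in> M" if "{n. \<not> P n} \<in> M" "{n. \<not> R n} \<in> M" for P R
      using MUn[OF that] by (rule Mmono) blast
    show "{n. \<not> R n} \<in> M" if "\<forall>n. P n \<longrightarrow> R n" "{n. \<not> P n} \<in> M" for P R
      by (rule Mmono[OF that(2)]) (use that(1) in blast)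
  qed
  then have ev: "eventually P p \<longleftrightarrow> {n. \<not> P n} \<in> M" for P
    unfolding p_def by (rule eventually_Abs_filter)
  have evin: "eventually (\<lambda>n. n \<in> A) p \<longleftrightarrow> A \<notin> M" for A
    using prime[of A] by (simp add: ev Compl_eq)
  have evout: "eventually (\<lambda>n. n \<notin> A) p \<longleftrightarrow> A \<in> M" for A
    by (simp add: ev)
  have "p \<noteq> bot"
  proof
    assume "p = bot"
    then have "UNIV \<in> M" using ev[of "\<lambda>n. False"] by simp
    then show False using Mmono[of UNIV Y] M(3) by simp
  qed
  then have "ultrafilter p" by (simp add: ultrafilter_def evin evout)
  then show ?thesis by (rule that) (use M in \<open>auto simp: evin\<close>)
qed

section \<open>The space of nonprincipal ultrafilters\<close>

definition star :: "nat set \<Rightarrow> nat filter set" where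
  "star A = {p \<in> topspace omega_star. eventually (\<lambda>n. n \<in> A) p}"

lemma topspace_beta_omega: "topspace beta_omega = {p. ultrafilter p}"
proof -
  have "eventually (\<lambda>n. n \<in> (UNIV :: nat set)) p" for p by simp
  then show ?thesis unfolding beta_omega_def topology_generated_by_topspace by blast
qed

text \<open>An ultrafilter containing a finite set contains one of its singletons and is then
  principal.\<close>

lemma in_omega_star_iff:
  "p \<in> topspace omega_star \<longleftrightarrow> ultrafilter p \<and> (\<forall>A. finite A \<longrightarrow> \<not> eventually (\<lambda>n. n \<in> A) p)"
proof -
  have "p \<in> topspace omega_star \<longleftrightarrow> ultrafilter p \<and> (\<forall>n. p \<noteq> principal {n})"
    by (auto simp: omega_star_def topspace_beta_omega)
  also have "\<dots> \<longleftrightarrow> ultrafilter p \<and> (\<forall>n. \<not> eventually (\<lambda>m. m \<in> {n}) p)"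
    by (cases "ultrafilter p") (simp_all add: ultrafilter_principal_iff)
  also have "\<dots> \<longleftrightarrow> ultrafilter p \<and> (\<forall>A. finite A \<longrightarrow> \<not> eventually (\<lambda>n. n \<in> A) p)"
  proof -
    have "\<not> eventually (\<lambda>n. n \<in> A) p"
      if "ultrafilter p" "\<forall>n. \<not> eventually (\<lambda>m. m \<in> {n}) p" "finite A" for A
      using ultrafilter_UN[OF that(1,3), of "\<lambda>n. {n}"] that(2) by simp
    moreover have "\<not> eventually (\<lambda>m. m \<in> {n}) p"
      if "\<forall>A. finite A \<longrightarrow> \<not> eventually (\<lambda>n. n \<in> A) p" for n
      using that[rule_format, of "{n}"] by simp
    ultimately show ?thesis by meson
  qed
  finally show ?thesis .
qed

lemma omega_star_ultrafilter: "p \<in> topspace omega_star \<Longrightarrow> ultrafilter p"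
  by (simp add: in_omega_star_iff)

lemma eventually_almost_subset:
  assumes p: "p \<in> topspace omega_star" "eventually (\<lambda>n. n \<in> A) p" and "finite (A - B)"
  shows "eventually (\<lambda>n. n \<in> B) p"
proof -
  have "eventually (\<lambda>n. n \<in> (A - B) \<union> B) p" using p(2) by (auto elim: eventually_mono)
  then show ?thesis
    using ultrafilter_Un[of p "A - B" B] p(1) assms(3) by (simp only: in_omega_star_iff) simp
qed

lemma star_mono: "finite (A - B) \<Longrightarrow> star A \<subseteq> star B"
  using eventually_almost_subset by (auto simp: star_def)

lemma star_Int: "star (A \<inter> B) = star A \<inter> star B"
  by (auto simp: star_def eventually_conj_iff)

lemma star_finite: "finite A \<Longrightarrow> star A = {}"
  by (auto simp: star_def in_omega_star_iff)

lemma star_UNIV: "star UNIV = topspace omega_star"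
  by (simp add: star_def)

lemma star_Un: "star (A \<union> B) = star A \<union> star B"
  unfolding star_def using ultrafilter_Un[OF omega_star_ultrafilter] by auto

lemma star_UN: "finite N \<Longrightarrow> star (\<Union>n\<in>N. A n) = (\<Union>n\<in>N. star (A n))"
  by (induction rule: finite_induct) (simp_all add: star_Un star_finite)

lemma star_subset: "A \<subseteq> B \<Longrightarrow> star A \<subseteq> star B"
  by (rule star_mono) (simp add: Diff_eq_empty_iff[THEN iffD2])

lemma star_avoiding_ideal:
  assumes "set_ideal J" "{F. finite F} \<subseteq> J" "Y \<notin> J"
  obtains p where "p \<in> star Y" "\<And>Z. Z \<in> J \<Longrightarrow> p \<notin> star Z"
proof -
  obtain p where p: "ultrafilter p" "eventually (\<lambda>n. n \<in> Y) p"
    "\<And>Z. Z \<in> J \<Longrightarrow> \<not> eventually (\<lambda>n. n \<in> Z) p"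
    by (rule ultrafilter_avoiding_ideal[OF assms(1,3)]) (rule that)
  then have "p \<in> topspace omega_star" using assms(2) by (auto simp: in_omega_star_iff)
  then show ?thesis using that[of p] p by (simp add: star_def)
qed

lemma set_ideal_finite: "set_ideal {F. finite F}"
  by (auto simp: set_ideal_def intro: finite_subset)

lemma star_nonempty:
  assumes "infinite A"
  shows "star A \<noteq> {}"
  using star_avoiding_ideal[OF set_ideal_finite, of A] assms by (metis empty_iff mem_Collect_eq subset_refl)

lemma openin_star: "openin omega_star (star A)"
proof -
  have "openin beta_omega {p. ultrafilter p \<and> eventually (\<lambda>n. n \<in> A) p}"
    unfolding beta_omega_def by (rule topology_generated_by_Basis) blast
  moreover have "star A = {p. ultrafilter p \<and> eventually (\<lambda>n. n \<in> A) p} \<inter>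
      (topspace beta_omega - range (\<lambda>n. principal {n}))"
    by (auto simp: star_def omega_star_def topspace_beta_omega)
  ultimately show ?thesis unfolding omega_star_def openin_subtopology by blast
qed

text \<open>The generating sets are closed under finite intersections and hence form a base.\<close>

lemma beta_omega_base:
  assumes "openin beta_omega U" "p \<in> U"
  shows "\<exists>A. eventually (\<lambda>n. n \<in> A) p \<and> {q. ultrafilter q \<and> eventually (\<lambda>n. n \<in> A) q} \<subseteq> U"
proof -
  have "generate_topology_on (range (\<lambda>A. {F. ultrafilter F \<and> eventually (\<lambda>n. n \<in> A) F})) U"
    using assms(1) unfolding beta_omega_def openin_topology_generated_by_iff .
  then show ?thesis using assms(2)
  proof (induction arbitrary: p)
    case (Int a b)
    have "p \<in> a" "p \<in> b" using Int.prems by auto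
    obtain A where "eventually (\<lambda>n. n \<in> A) p"
      "{q. ultrafilter q \<and> eventually (\<lambda>n. n \<in> A) q} \<subseteq> a"
      using Int.IH(1)[OF \<open>p \<in> a\<close>] by (elim exE conjE)
    moreover obtain B where "eventually (\<lambda>n. n \<in> B) p"
      "{q. ultrafilter q \<and> eventually (\<lambda>n. n \<in> B) q} \<subseteq> b"
      using Int.IH(2)[OF \<open>p \<in> b\<close>] by (elim exE conjE)
    ultimately show ?case by (intro exI[of _ "A \<inter> B"]) (auto simp: eventually_conj_iff)
  next
    case (UN K)
    then obtain k where k: "k \<in> K" "p \<in> k" by blast
    obtain A where "eventually (\<lambda>n. n \<in> A) p"
      "{q. ultrafilter q \<and> eventually (\<lambda>n. n \<in> A) q} \<subseteq> k"
      using UN.IH[OF k] by (elim exE conjE)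
    then show ?case using k(1) by (intro exI[of _ A]) auto
  qed auto
qed

lemma omega_star_base:
  assumes "openin omega_star U" "p \<in> U"
  obtains A where "p \<in> star A" "star A \<subseteq> U"
proof -
  obtain T where T: "openin beta_omega T"
    "U = T \<inter> (topspace beta_omega - range (\<lambda>n. principal {n}))"
    using assms(1) unfolding omega_star_def openin_subtopology by blast
  then have p: "p \<in> T" using assms(2) by blast
  obtain A where A: "eventually (\<lambda>n. n \<in> A) p"
    "{q. ultrafilter q \<and> eventually (\<lambda>n. n \<in> A) q} \<subseteq> T"
    using beta_omega_base[OF T(1) p] by (elim exE conjE)
  have "p \<in> star A" using A(1) assms openin_subset by (auto simp: star_def)
  moreover have "star A \<subseteq> U"
    using A(2) T(2) by (auto simp: star_def omega_star_def topspace_beta_omega)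
  ultimately show ?thesis by (rule that)
qed

text \<open>Each \<open>Z a\<close> lies outside \<open>J\<close> and so belongs to an ultrafilter
  avoiding \<open>J\<close>. Different indices give different ultrafilters, as a common one would
  contain \<open>Z a \<inter> Z b\<close>, a finite union of pieces from \<open>J\<close>.\<close>

lemma continuum_star_points:
  fixes P :: "nat \<Rightarrow> nat set"
  assumes "disjoint_family P" and J: "set_ideal J" "{F. finite F} \<subseteq> J" and "\<And>n. P n \<in> J"
    and "\<And>n. P n \<subseteq> Y" and pos: "\<And>N. infinite N \<Longrightarrow> (\<Union>n\<in>N. P n) \<notin> J"
  shows "|UNIV :: nat set set| \<le>o |{p \<in> star Y. \<forall>Z\<in>J. p \<notin> star Z}|"
proof -
  obtain Z :: "nat set \<Rightarrow> nat set"
    where Z: "\<And>a. \<exists>N. infinite N \<and> Z a = (\<Union>n\<in>N. P n)"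
      "\<And>a b. a \<noteq> b \<Longrightarrow> \<exists>N. finite N \<and> Z a \<inter> Z b = (\<Union>n\<in>N. P n)"
    by (rule continuum_positive_subsets[OF assms(1)]) blast
  have "\<exists>p. p \<in> star (Z a) \<and> (\<forall>B\<in>J. p \<notin> star B)" for a
  proof -
    have "Z a \<notin> J" using Z(1)[of a] pos by auto
    then show ?thesis by (rule star_avoiding_ideal[OF J]) blast
  qed
  then obtain p where p: "\<And>a. p a \<in> star (Z a)" "\<And>a B. B \<in> J \<Longrightarrow> p a \<notin> star B" by metis
  have "inj p"
  proof (rule injI, rule ccontr)
    fix a b assume "p a = p b" "a \<noteq> b"
    then have "p a \<in> star (Z a \<inter> Z b)" using p(1)[of a] p(1)[of b] by (simp add: star_Int)
    moreover have "Z a \<inter> Z b \<in> J"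
      using Z(2)[OF \<open>a \<noteq> b\<close>] set_ideal_finite_Union[OF J(1) _ assms(4)] by auto
    ultimately show False using p(2) by blast
  qed
  moreover have "Z a \<subseteq> Y" for a using Z(1)[of a] by (elim exE conjE) (simp add: UN_subset_iff assms(5))
  then have "star (Z a) \<subseteq> star Y" for a by (metis Diff_eq_empty_iff finite.emptyI star_mono)
  then have "p ` UNIV \<subseteq> {q \<in> star Y. \<forall>Z\<in>J. q \<notin> star Z}" using p by blast
  ultimately show ?thesis using card_of_ordLeqI[of p UNIV] by blast
qed

lemma continuum_star_infinite:
  assumes "infinite Y"
  shows "|UNIV :: nat set set| \<le>o |star Y|"
proof -
  have inj: "inj (enumerate Y)" and img: "range (enumerate Y) = Y"
    using bij_enumerate[OF assms] by (auto simp: bij_betw_def)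
  have "|UNIV :: nat set set| \<le>o |{p \<in> star Y. \<forall>Z\<in>{F. finite F}. p \<notin> star Z}|"
  proof (rule continuum_star_points[where P = "\<lambda>n. {enumerate Y n}", OF _ set_ideal_finite])
    show "disjoint_family (\<lambda>n. {enumerate Y n})"
      using inj by (auto simp: disjoint_family_on_def dest: injD)
    show "(\<Union>n\<in>N. {enumerate Y n}) \<notin> {F. finite F}" if "infinite N" for N
      using that inj finite_imageD[of "enumerate Y" N] inj_on_subset[OF inj]
      by (auto simp: UNION_singleton_eq_range)
  qed (use img in auto)
  then show ?thesis
    using card_of_mono1[of "{p \<in> star Y. \<forall>Z\<in>{F. finite F}. p \<notin> star Z}" "star Y"]
      ordLeq_transitive by blast
qed

section \<open>Embeddings of the space induced by injections\<close>

lemma filtermap_omega_star: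
  assumes "inj h" "p \<in> topspace omega_star"
  shows "filtermap h p \<in> topspace omega_star"
proof -
  have p: "ultrafilter p" using assms(2) by (rule omega_star_ultrafilter)
  have "eventually (\<lambda>n. h n \<in> A) p \<or> eventually (\<lambda>n. h n \<notin> A) p" for A
    using ultrafilter_Compl[OF p, of "h -` A"] by (auto simp: vimage_def)
  then have "ultrafilter (filtermap h p)"
    using p by (simp add: ultrafilter_def eventually_filtermap filtermap_bot_iff)
  moreover have "\<not> eventually (\<lambda>n. n \<in> A) (filtermap h p)" if "finite A" for A
    using star_finite[OF finite_vimageI[OF that assms(1)]] assms(2)
    by (simp add: star_def eventually_filtermap)
  ultimately show ?thesis by (simp add: in_omega_star_iff)
qed

lemma filtermap_in_star_iff:
  "inj h \<Longrightarrow> p \<in> topspace omega_star \<Longrightarrow> filtermap h p \<in> star A \<longleftrightarrow> p \<in> star (h -` A)"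
  using filtermap_omega_star by (simp add: star_def eventually_filtermap)

lemma filtercomap_filtermap_inj:
  assumes "inj h"
  shows "filtercomap h (filtermap h p) = p"
  unfolding filter_eq_iff eventually_filtercomap eventually_filtermap
proof (intro allI iffI)
  show "eventually P p" if "\<exists>Q. eventually (\<lambda>x. Q (h x)) p \<and> (\<forall>x. Q (h x) \<longrightarrow> P x)" for P
    using that by (auto elim: eventually_mono)
  show "\<exists>Q. eventually (\<lambda>x. Q (h x)) p \<and> (\<forall>x. Q (h x) \<longrightarrow> P x)" if "eventually P p" for P
    using that assms by (intro exI[of _ "\<lambda>y. P (the_inv h y)"]) (simp add: the_inv_f_f)
qed

section \<open>Completely separable MAD families\<close>

locale completely_separable_mad =
  fixes \<A> :: "nat set set"
  assumes mad: "MAD_family \<A>" and cs: "completely_separable \<A>"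
begin

lemma infinite_member: "A \<in> \<A> \<Longrightarrow> infinite A"
  using mad by (simp add: MAD_family_def AD_family_def)

lemma almost_disjoint: "A \<in> \<A> \<Longrightarrow> B \<in> \<A> \<Longrightarrow> A \<noteq> B \<Longrightarrow> finite (A \<inter> B)"
  using mad by (simp add: MAD_family_def AD_family_def)

text \<open>The ideal generated by \<open>\<A>\<close> and the finite sets, written out.\<close>

definition small :: "nat set \<Rightarrow> bool" where
  "small Y \<longleftrightarrow> (\<exists>\<F>\<subseteq>\<A>. finite \<F> \<and> finite (Y - \<Union>\<F>))"

lemma small_finite: "finite Y \<Longrightarrow> small Y"
  unfolding small_def by (intro exI[of _ "{}"]) simp

lemma small_subset_member: "A \<in> \<A> \<Longrightarrow> Y \<subseteq> A \<Longrightarrow> small Y"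
  unfolding small_def by (intro exI[of _ "{A}"]) (simp add: Diff_eq_empty_iff[THEN iffD2])

lemma small_subset: "small Y \<Longrightarrow> Z \<subseteq> Y \<Longrightarrow> small Z"
  unfolding small_def by (metis Diff_mono finite_subset subset_refl)

lemma small_Un:
  assumes "small Y" "small Z"
  shows "small (Y \<union> Z)"
proof -
  obtain \<F> \<G> where "\<F> \<subseteq> \<A>" "finite \<F>" "finite (Y - \<Union>\<F>)" "\<G> \<subseteq> \<A>" "finite \<G>" "finite (Z - \<Union>\<G>)"
    using assms by (auto simp: small_def)
  moreover have "Y \<union> Z - \<Union>(\<F> \<union> \<G>) \<subseteq> (Y - \<Union>\<F>) \<union> (Z - \<Union>\<G>)" by auto
  ultimately have "\<F> \<union> \<G> \<subseteq> \<A>" "finite (\<F> \<union> \<G>)" "finite (Y \<union> Z - \<Union>(\<F> \<union> \<G>))"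
    by (auto intro: finite_subset)
  then show ?thesis unfolding small_def by (intro exI[of _ "\<F> \<union> \<G>"]) simp
qed

lemma set_ideal_small: "set_ideal (Collect small)"
  using small_Un small_subset small_finite[of "{}"] by (simp add: set_ideal_def)

text \<open>Complete separability leaves one other case, that \<open>Y\<close> is almost disjoint
  from all members. Then \<open>Y\<close> belongs to \<open>\<A>\<close> by maximality and is small
  after all.\<close>

lemma not_small_contains_member:
  assumes "\<not> small Y"
  obtains A where "A \<in> \<A>" "finite (A - Y)"
proof -
  have "set_ideal hull (\<A> \<union> {F. finite F}) \<subseteq> Collect small"
    using small_finite small_subset_member set_ideal_small by (intro hull_minimal) auto
  then have "Y \<notin> set_ideal hull (\<A> \<union> {F. finite F})" using assms by blast
  then consider "\<forall>A\<in>\<A>. finite (A \<inter> Y)" | A where "A \<in> \<A>" "finite (A - Y)"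
    using cs unfolding completely_separable_def by blast
  then show ?thesis
  proof cases
    case 1
    have "infinite Y" using assms small_finite by blast
    then have "AD_family (insert Y \<A>)"
      using 1 infinite_member almost_disjoint by (auto simp: AD_family_def Int_commute)
    then have "Y \<in> \<A>" using mad unfolding MAD_family_def by blast
    then show ?thesis using small_subset_member assms by blast
  qed (use that in blast)
qed

text \<open>Were there only finitely many, removing them from \<open>Y\<close> would leave a set
  that is not small. It almost contains a member, which meets \<open>Y\<close> in an infinite set
  and so has itself been removed.\<close>

lemma not_small_meets_infinitely_many:
  assumes "\<not> small Y"
  shows "infinite {A \<in> \<A>. infinite (A \<inter> Y)}"
proof
  define \<F> where "\<F> = {A \<in> \<A>. infinite (A \<inter> Y)}"
  assume "finite {A \<in> \<A>. infinite (A \<inter> Y)}"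
  then have fin: "finite \<F>" "\<F> \<subseteq> \<A>" by (auto simp: \<F>_def)
  then have "small (\<Union>\<F>)" unfolding small_def by (intro exI[of _ \<F>]) simp
  then have "\<not> small (Y - \<Union>\<F>)"
    using assms small_Un[of "Y - \<Union>\<F>" "\<Union>\<F>"] small_subset[of _ Y] by blast
  then obtain A where A: "A \<in> \<A>" "finite (A - (Y - \<Union>\<F>))" by (rule not_small_contains_member)
  have "A \<subseteq> (A - (Y - \<Union>\<F>)) \<union> (A \<inter> Y)" by auto
  then have "infinite (A \<inter> Y)" using A infinite_member finite_subset by blast
  then have "A \<in> \<F>" using A by (simp add: \<F>_def)
  then have "A \<subseteq> A - (Y - \<Union>\<F>)" by auto
  then show False using A infinite_member finite_subset by blast
qed

lemma not_small_UNIV: "\<not> small UNIV"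
proof
  assume "small UNIV"
  then obtain \<F> where \<F>: "\<F> \<subseteq> \<A>" "finite \<F>" "finite (UNIV - \<Union>\<F>)" by (auto simp: small_def)
  have "infinite \<A>" using mad by (simp add: MAD_family_def)
  then have "infinite (\<A> - \<F>)" using \<F>(2) by (rule Diff_infinite_finite[rotated])
  then obtain A where A: "A \<in> \<A>" "A \<notin> \<F>" by (metis Diff_iff finite.emptyI equals0I)
  have "finite (\<Union>B\<in>\<F>. A \<inter> B)"
    by (intro finite_UN_I almost_disjoint) (use A \<F> in auto)
  moreover have "A \<subseteq> (UNIV - \<Union>\<F>) \<union> (\<Union>B\<in>\<F>. A \<inter> B)" by auto
  ultimately show False using infinite_member[OF A(1)] \<F>(3) finite_subset by blast
qed

text \<open>Each \<open>P n\<close> is only half of its member of \<open>\<A>\<close>, which gives the last property: no member is almost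
  covered by finitely many pieces.\<close>

lemma positive_pieces:
  assumes "\<not> small Y"
  obtains P :: "nat \<Rightarrow> nat set"
  where "disjoint_family P" "\<And>n. P n \<subseteq> Y" "\<And>n. small (P n)"
    "\<And>N. infinite N \<Longrightarrow> \<not> small (\<Union>n\<in>N. P n)"
    "\<And>N B. finite N \<Longrightarrow> B \<in> \<A> \<Longrightarrow> infinite (B - (\<Union>n\<in>N. P n))"
proof -
  obtain A :: "nat \<Rightarrow> nat set" where A: "inj A" "range A \<subseteq> {A \<in> \<A>. infinite (A \<inter> Y)}"
    using infinite_countable_subset[OF not_small_meets_infinitely_many[OF assms]] by blast
  have mem: "A n \<in> \<A>" and inf: "infinite (A n \<inter> Y)" for n using A(2) by auto
  have AD: "finite (A n \<inter> B)" if "B \<in> \<A>" "B \<noteq> A n" for n B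
    using almost_disjoint[OF mem that(1)] that(2) by blast
  \<comment> \<open>The traces on \<open>Y\<close> are made disjoint; almost disjointness limits the
    loss to finitely many points.\<close>
  define Q where "Q n = A n \<inter> Y - (\<Union>i<n. A i)" for n
  have "infinite (Q n)" for n
  proof
    assume "finite (Q n)"
    moreover have "finite (\<Union>i<n. A n \<inter> A i)"
      by (intro finite_UN_I finite_lessThan AD mem) (use A(1) in \<open>auto dest: injD\<close>)
    moreover have "A n \<inter> Y \<subseteq> Q n \<union> (\<Union>i<n. A n \<inter> A i)" by (auto simp: Q_def)
    ultimately show False using inf finite_subset by blast
  qed
  then have "\<exists>B\<subseteq>Q n. infinite B \<and> infinite (Q n - B)" for n
    using infinite_half by metis
  then obtain P where P: "\<And>n. P n \<subseteq> Q n" "\<And>n. infinite (P n)" "\<And>n. infinite (Q n - P n)"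
    by metis
  have PA: "P n \<subseteq> A n" for n using P(1)[of n] by (auto simp: Q_def)
  have "Q m \<inter> Q n = {}" if "m \<noteq> n" for m n
    using that by (cases m n rule: linorder_cases) (auto simp: Q_def)
  then have "disjoint_family P" using P(1) unfolding disjoint_family_on_def by blast
  moreover have "P n \<subseteq> Y" for n using P(1)[of n] by (auto simp: Q_def)
  moreover have "small (P n)" for n using small_subset_member[OF mem PA] .
  moreover have "\<not> small (\<Union>n\<in>N. P n)" if N: "infinite N" for N
  proof
    assume "small (\<Union>n\<in>N. P n)"
    then obtain \<F> where \<F>: "\<F> \<subseteq> \<A>" "finite \<F>" "finite ((\<Union>n\<in>N. P n) - \<Union>\<F>)"
      by (auto simp: small_def)
    have "infinite (A ` N)" using N A(1) finite_imageD inj_on_subset by blast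
    then have "infinite (A ` N - \<F>)" using \<F>(2) by (rule Diff_infinite_finite[rotated])
    then have "A ` N - \<F> \<noteq> {}" by (metis finite.emptyI)
    then obtain n where n: "n \<in> N" "A n \<notin> \<F>" by auto
    have "finite (\<Union>B\<in>\<F>. A n \<inter> B)" by (intro finite_UN_I AD) (use \<F> n in auto)
    moreover have "P n \<subseteq> ((\<Union>n\<in>N. P n) - \<Union>\<F>) \<union> (\<Union>B\<in>\<F>. A n \<inter> B)" using n PA[of n] by blast
    ultimately show False using P(2)[of n] \<F>(3) finite_subset by blast
  qed
  moreover have "infinite (B - (\<Union>n\<in>N. P n))" if N: "finite N" and B: "B \<in> \<A>" for N B
  proof
    assume fin: "finite (B - (\<Union>n\<in>N. P n))"
    \<comment> \<open>The overlap of \<open>B\<close> with the other members involved is finite.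
      Apart from it, the pieces cover at most the half \<open>P n\<close> of \<open>B = A n\<close>,
      or nothing of \<open>B\<close> at all.\<close>
    define R where "R = (\<Union>m\<in>{m \<in> N. A m \<noteq> B}. A m \<inter> B)"
    have "finite R" unfolding R_def by (intro finite_UN_I AD) (use N B in auto)
    show False
    proof (cases "\<exists>n\<in>N. B = A n")
      case True
      then obtain n where n: "n \<in> N" "B = A n" by blast
      have "Q n - P n \<subseteq> (B - (\<Union>n\<in>N. P n)) \<union> R"
      proof
        fix x assume x: "x \<in> Q n - P n"
        then have "x \<in> B" using n by (auto simp: Q_def)
        show "x \<in> (B - (\<Union>n\<in>N. P n)) \<union> R"
        proof (cases "x \<in> (\<Union>n\<in>N. P n)")
          case True
          then obtain m where m: "m \<in> N" "x \<in> P m" by blast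
          then have "A m \<noteq> B" using x n A(1) by (auto dest: injD)
          then show ?thesis using m PA \<open>x \<in> B\<close> by (auto simp: R_def)
        qed (use \<open>x \<in> B\<close> in blast)
      qed
      then show False using fin \<open>finite R\<close> P(3) finite_subset by blast
    next
      case False
      then have "B \<subseteq> (B - (\<Union>n\<in>N. P n)) \<union> R" using PA unfolding R_def by blast
      then show False using fin \<open>finite R\<close> infinite_member[OF B] finite_subset by blast
    qed
  qed
  ultimately show ?thesis by (rule that)
qed

text \<open>Continuum many unions \<open>Z a\<close> of pieces each almost contain a member. A
  member serving two of them would be almost covered by the finitely many common pieces, which
  \<open>positive_pieces\<close> excludes.\<close>

lemma continuum_members:
  assumes "\<not> small Y"
  shows "|UNIV :: nat set set| \<le>o |{A \<in> \<A>. finite (A - Y)}|"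
proof -
  obtain P :: "nat \<Rightarrow> nat set" where P: "disjoint_family P" "\<And>n. P n \<subseteq> Y"
    "\<And>N. infinite N \<Longrightarrow> \<not> small (\<Union>n\<in>N. P n)"
    "\<And>N B. finite N \<Longrightarrow> B \<in> \<A> \<Longrightarrow> infinite (B - (\<Union>n\<in>N. P n))"
    by (rule positive_pieces[OF assms]) (rule that)
  obtain Z :: "nat set \<Rightarrow> nat set"
    where Z: "\<And>a. \<exists>N. infinite N \<and> Z a = (\<Union>n\<in>N. P n)"
      "\<And>a b. a \<noteq> b \<Longrightarrow> \<exists>N. finite N \<and> Z a \<inter> Z b = (\<Union>n\<in>N. P n)"
    by (rule continuum_positive_subsets[OF P(1)]) blast
  have "\<exists>A\<in>\<A>. finite (A - Z a)" for a
  proof -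
    have "\<not> small (Z a)" using Z(1)[of a] P(3) by auto
    then show ?thesis by (rule not_small_contains_member) blast
  qed
  then obtain A where A: "\<And>a. A a \<in> \<A>" "\<And>a. finite (A a - Z a)" by metis
  have "inj A"
  proof (rule injI, rule ccontr)
    fix a b assume "A a = A b" "a \<noteq> b"
    obtain N where N: "finite N" "Z a \<inter> Z b = (\<Union>n\<in>N. P n)"
      using Z(2)[OF \<open>a \<noteq> b\<close>] by (elim exE conjE)
    have "A a - Z a \<inter> Z b = (A a - Z a) \<union> (A b - Z b)" using \<open>A a = A b\<close> by auto
    then show False using P(4)[OF N(1) A(1)[of a]] N(2) A(2)[of a] A(2)[of b] by simp
  qed
  moreover have "finite (A a - Y)" for a
  proof -
    have "Z a \<subseteq> Y" using Z(1)[of a] by (elim exE conjE) (simp add: UN_subset_iff P(2))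
    then have "A a - Y \<subseteq> A a - Z a" by auto
    then show ?thesis using A(2) finite_subset by blast
  qed
  then have "A ` UNIV \<subseteq> {A \<in> \<A>. finite (A - Y)}" using A(1) by auto
  ultimately show ?thesis using card_of_ordLeqI[of A UNIV] by blast
qed

definition free :: "nat filter set" where
  "free = topspace omega_star - (\<Union>A\<in>\<A>. star A)"

text \<open>Ultrafilters without small sets avoid every \<open>star A\<close> with \<open>A\<close>
  in \<open>\<A>\<close>, and \<open>continuum_star_points\<close> for the ideal of small sets
  provides continuum many.\<close>

lemma continuum_free:
  assumes "\<not> small Y"
  shows "|UNIV :: nat set set| \<le>o |star Y \<inter> free|"
proof -
  obtain P :: "nat \<Rightarrow> nat set" where P: "disjoint_family P" "\<And>n. P n \<subseteq> Y" "\<And>n. small (P n)"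
    "\<And>N. infinite N \<Longrightarrow> \<not> small (\<Union>n\<in>N. P n)"
    by (rule positive_pieces[OF assms]) (rule that)
  have "|UNIV :: nat set set| \<le>o |{p \<in> star Y. \<forall>Z\<in>Collect small. p \<notin> star Z}|"
    by (rule continuum_star_points[OF P(1) set_ideal_small]) (use P small_finite in auto)
  moreover have "{p \<in> star Y. \<forall>Z\<in>Collect small. p \<notin> star Z} \<subseteq> star Y \<inter> free"
    using small_subset_member by (auto simp: free_def star_def)
  ultimately show ?thesis using card_of_mono1 ordLeq_transitive by blast
qed

end

text \<open>Members of hue \<open>Inl n\<close> are kept in reserve: in a cell that is a proper countable intersection they
  are matched with the differences of consecutive sets of the intersection.\<close>

locale coloured_mad = completely_separable_mad \<A> for \<A> +
  fixes hue :: "nat set \<Rightarrow> nat + fm" and mark :: "nat filter \<Rightarrow> fm"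
  assumes hue: "\<not> small Y \<Longrightarrow> \<exists>A\<in>\<A>. finite (A - Y) \<and> hue A = c"
    and mark: "infinite Y \<Longrightarrow> \<exists>q\<in>star Y. mark q = \<phi>"
    and mark_free: "\<not> small Y \<Longrightarrow> \<exists>q\<in>star Y \<inter> free. mark q = \<phi>"

lemma (in completely_separable_mad) coloured_mad_exists:
  obtains hue mark where "coloured_mad \<A> hue mark"
proof -
  obtain hue :: "nat set \<Rightarrow> nat + fm"
    where hue: "\<And>Y c. \<not> small Y \<Longrightarrow> \<exists>A\<in>{A \<in> \<A>. finite (A - Y)}. hue A = c"
    by (rule colouring_exists[of "\<lambda>Y. \<not> small Y", OF continuum_members]) (assumption, rule that)
  \<comment> \<open>A single \<open>mark\<close> has to serve for all infinite sets and, inside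
    \<open>free\<close>, for all sets that are not small; hence the target depends on
    \<open>small Y\<close>.\<close>
  have "|UNIV :: nat set set| \<le>o |if small Y then star Y else star Y \<inter> free|" if "infinite Y" for Y
    using continuum_star_infinite[OF that] continuum_free[of Y] by simp
  note large = this
  obtain mark :: "nat filter \<Rightarrow> fm" where mark:
    "\<And>Y \<phi>. infinite Y \<Longrightarrow> \<exists>q\<in>(if small Y then star Y else star Y \<inter> free). mark q = \<phi>"
    by (rule colouring_exists[of infinite "\<lambda>Y. if small Y then star Y else star Y \<inter> free", OF large])
      (assumption, rule that)
  have "coloured_mad \<A> hue mark"
  proof
    show "\<exists>A\<in>\<A>. finite (A - Y) \<and> hue A = c" if "\<not> small Y" for Y c
      using hue[OF that, of c] by auto
    show "\<exists>q\<in>star Y. mark q = \<phi>" if "infinite Y" for Y \<phi>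
      using mark[OF that, of \<phi>] by (auto split: if_splits)
    show "\<exists>q\<in>star Y \<inter> free. mark q = \<phi>" if "\<not> small Y" for Y \<phi>
      using mark[of Y \<phi>] that small_finite by auto
  qed
  then show ?thesis by (rule that)
qed

text \<open>An uncovered number \<open>i\<close> is put into piece number \<open>i\<close>, so each
  piece gains at most one point.\<close>

lemma absorb_leftover:
  fixes C :: "nat \<Rightarrow> nat set"
  assumes "disjoint_family C" "\<And>i. C i \<subseteq> B"
  defines "C' \<equiv> \<lambda>i. C i \<union> ({i} \<inter> (B - (\<Union>j. C j)))"
  shows "disjoint_family C'" "(\<Union>i. C' i) = B" "C i \<subseteq> C' i" "finite (C' i - C i)"
proof -
  show "disjoint_family C'"
    using disjoint_family_onD[OF assms(1)] unfolding disjoint_family_on_def C'_def by auto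
  show "(\<Union>i. C' i) = B" using assms(2) unfolding C'_def by auto
  show "C i \<subseteq> C' i" by (simp add: C'_def)
  show "finite (C' i - C i)" by (rule finite_subset[of _ "{i}"]) (auto simp: C'_def)
qed

section \<open>Cells of the ultrafilter space and their charts\<close>

definition star_cells :: "nat filter set set" where
  "star_cells = {K. \<exists>\<B>. countable \<B> \<and> K = {p \<in> topspace omega_star. \<forall>B\<in>\<B>. p \<in> star B}}"

lemma star_cells_decseq:
  assumes "K \<in> star_cells"
  obtains B where "decseq B" "K = (\<Inter>n. star (B n))"
proof -
  obtain \<B> where \<B>: "countable \<B>" "K = {p \<in> topspace omega_star. \<forall>B\<in>\<B>. p \<in> star B}"
    using assms by (auto simp: star_cells_def)
  \<comment> \<open>Inserting \<open>UNIV\<close> does not affect the intersection and makes the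
    family nonempty, so it can be enumerated.\<close>
  define G where "G = from_nat_into (insert UNIV \<B>)"
  have range_G: "range G = insert UNIV \<B>"
    unfolding G_def using \<B>(1) by (intro range_from_nat_into) auto
  have Inter_G: "star (\<Inter>i\<le>n. G i) = (\<Inter>i\<le>n. star (G i))" for n
    by (induction n) (simp_all add: atMost_Suc star_Int)
  have "(\<Inter>n. star (\<Inter>i\<le>n. G i)) = (\<Inter>i. star (G i))" unfolding Inter_G by auto
  also have "\<dots> = (\<Inter>B\<in>insert UNIV \<B>. star B)" by (simp flip: range_G)
  also have "\<dots> = K" using \<B>(2) by (auto simp: star_UNIV)
  finally have "K = (\<Inter>n. star (\<Inter>i\<le>n. G i))" ..
  moreover have "decseq (\<lambda>n. \<Inter>i\<le>n. G i)" by (rule decseq_SucI) (auto simp: atMost_Suc)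
  ultimately show ?thesis using that by blast
qed

context coloured_mad
begin

text \<open>The differences \<open>E i - E (Suc i)\<close> are disjoint columns, and
  \<open>h\<close> carries \<open>A i\<close> onto column \<open>i\<close> up to finite sets. Taking
  all columns away from \<open>E 0\<close> leaves the intersection.\<close>

lemma columns_chart:
  fixes E A :: "nat \<Rightarrow> nat set"
  assumes E: "decseq E" "\<And>i. infinite (E i - E (Suc i))"
    and A: "\<And>i. A i \<in> \<A>" "inj A"
  obtains h where "inj h" "(\<Inter>i. star (E i)) = star (range h) - (\<Union>i. star (h ` A i))"
proof -
  have dec: "E n \<subseteq> E m" if "m \<le> n" for m n using E(1) that by (auto simp: decseq_def)
  define C where "C i = E i - E (Suc i)" for i
  have disjC: "disjoint_family C"
    unfolding disjoint_family_on_def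
  proof (intro ballI impI)
    fix m n :: nat assume "m \<noteq> n"
    then show "C m \<inter> C n = {}"
      using dec[of "Suc m" n] dec[of "Suc n" m]
      by (cases m n rule: linorder_cases) (auto simp: C_def)
  qed
  have subC: "C i \<subseteq> E 0" for i using dec[of 0 i] by (auto simp: C_def)
  \<comment> \<open>The columns here, and the disjointed members below, need not cover
    \<open>E 0\<close> and \<open>UNIV\<close>. Both are completed by finite changes, which
    \<open>star\<close> does not see.\<close>
  define C' where "C' = (\<lambda>i. C i \<union> ({i} \<inter> (E 0 - (\<Union>j. C j))))"
  have C': "disjoint_family C'" "(\<Union>i. C' i) = E 0" "\<And>i. C i \<subseteq> C' i" "\<And>i. finite (C' i - C i)"
    unfolding C'_def using absorb_leftover[OF disjC subC] by auto
  define P where "P i = A i - (\<Union>j<i. A j)" for i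
  have disjP: "disjoint_family P"
    unfolding disjoint_family_on_def
  proof (intro ballI impI)
    fix m n :: nat assume "m \<noteq> n"
    then show "P m \<inter> P n = {}" by (cases m n rule: linorder_cases) (auto simp: P_def)
  qed
  define P' where "P' = (\<lambda>i. P i \<union> ({i} \<inter> (UNIV - (\<Union>j. P j))))"
  have P': "disjoint_family P'" "(\<Union>i. P' i) = UNIV" "\<And>i. P i \<subseteq> P' i" "\<And>i. finite (P' i - P i)"
    unfolding P'_def using absorb_leftover[OF disjP subset_UNIV] by auto
  have finAP: "finite (A i - P i)" for i
  proof -
    have "finite (\<Union>j<i. A i \<inter> A j)"
      by (intro finite_UN_I finite_lessThan almost_disjoint A(1)) (use A(2) in \<open>auto dest: injD\<close>)
    moreover have "A i - P i \<subseteq> (\<Union>j<i. A i \<inter> A j)" by (auto simp: P_def)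
    ultimately show ?thesis using finite_subset by blast
  qed
  have infP': "infinite (P' i)" for i
  proof -
    have "A i \<subseteq> (A i - P i) \<union> P i" by auto
    then have "infinite (P i)" using infinite_member[OF A(1)[of i]] finAP[of i] finite_subset by blast
    then show ?thesis using P'(3) finite_subset by blast
  qed
  have infC': "infinite (C' i)" for i
    using C'(3)[of i] E(2)[of i] finite_subset by (auto simp: C_def)
  obtain h where h: "inj h" "\<And>i. h ` P' i = C' i"
    using match_partitions[OF P'(1) C'(1) infP' infC' P'(2)] by blast
  have "range h = h ` (\<Union>i. P' i)" by (simp only: P'(2))
  also have "\<dots> = E 0" unfolding image_UN h(2) by (rule C'(2))
  finally have range_h: "range h = E 0" .
  have "star (h ` A i) = star (C i)" for i
  proof
    have "h ` A i - C i \<subseteq> h ` (A i - P i) \<union> (C' i - C i)" using P'(3)[of i] h(2)[of i] by blast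
    then have "finite (h ` A i - C i)" using finAP C'(4) finite_subset by blast
    then show "star (h ` A i) \<subseteq> star (C i)" by (rule star_mono)
    have "P i \<subseteq> A i" by (auto simp: P_def)
    then have "C i - h ` A i \<subseteq> h ` (P' i - P i)" using C'(3)[of i] h(2)[of i] by blast
    then have "finite (C i - h ` A i)" using P'(4) finite_subset by blast
    then show "star (C i) \<subseteq> star (h ` A i)" by (rule star_mono)
  qed
  \<comment> \<open>Passing from \<open>E i\<close> to \<open>E (Suc i)\<close> removes exactly
    \<open>C i\<close>, so an ultrafilter avoiding all columns stays in every
    \<open>star (E i)\<close>.\<close>
  moreover have "(\<Inter>i. star (E i)) = star (E 0) - (\<Union>i. star (C i))"
  proof (intro equalityI subsetI)
    fix p assume p: "p \<in> (\<Inter>i. star (E i))"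
    have "C i \<inter> E (Suc i) = {}" for i by (auto simp: C_def)
    then have "star (C i) \<inter> star (E (Suc i)) = {}" for i
      using star_Int[of "C i" "E (Suc i)"] star_finite[of "{}"] by simp
    then show "p \<in> star (E 0) - (\<Union>i. star (C i))" using p by blast
  next
    fix p assume p: "p \<in> star (E 0) - (\<Union>i. star (C i))"
    have "p \<in> star (E i)" for i
    proof (induction i)
      case (Suc i)
      have "E i = C i \<union> E (Suc i)" using dec[of i "Suc i"] by (auto simp: C_def)
      then have "star (E i) = star (C i) \<union> star (E (Suc i))" using star_Un by metis
      then show ?case using Suc p by blast
    qed (use p in blast)
    then show "p \<in> (\<Inter>i. star (E i))" by blast
  qed
  ultimately show ?thesis using that[OF h(1)] by (simp add: range_h)
qed

text \<open>A decreasing sequence either is eventually constant modulo finite sets, and the cell is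
  clopen, or has a subsequence with infinite consecutive differences, and
  \<open>columns_chart\<close> applies.\<close>

lemma cell_chart:
  assumes "K \<in> star_cells" "K \<noteq> {}"
  obtains h \<A>\<^sub>0 where "inj h" "\<A>\<^sub>0 \<subseteq> \<A>" "\<And>A. A \<in> \<A>\<^sub>0 \<Longrightarrow> \<exists>n. hue A = Inl n"
    "K = star (range h) - (\<Union>A\<in>\<A>\<^sub>0. star (h ` A))"
proof -
  obtain B where B: "decseq B" "K = (\<Inter>n. star (B n))" by (rule star_cells_decseq[OF assms(1)])
  have dec: "B n \<subseteq> B m" if "m \<le> n" for m n using B(1) that by (auto simp: decseq_def)
  show ?thesis
  proof (cases "\<exists>N. \<forall>n\<ge>N. finite (B N - B n)")
    case True
    then obtain N where N: "\<And>n. n \<ge> N \<Longrightarrow> finite (B N - B n)" by blast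
    have "star (B N) \<subseteq> star (B n)" for n
      using star_mono[OF N, of n] star_subset[OF dec, of n N] by (cases "N \<le> n") auto
    then have K: "K = star (B N)" using B(2) by blast
    then have "infinite (B N)" using assms(2) star_finite by blast
    then have "bij_betw (enumerate (B N)) UNIV (B N)" by (rule bij_enumerate)
    then have "inj (enumerate (B N))" "range (enumerate (B N)) = B N" by (auto simp: bij_betw_def)
    then show ?thesis using that[of "enumerate (B N)" "{}"] K by simp
  next
    case False
    then have "\<exists>n. infinite (B N - B n)" for N by blast
    then obtain g where g: "\<And>N. infinite (B N - B (g N))" by metis
    define k where "k = rec_nat 0 (\<lambda>_. g)"
    have k_Suc: "k (Suc i) = g (k i)" for i by (simp add: k_def)
    have "N < g N" for N
    proof (rule ccontr)
      assume "\<not> N < g N"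
      then have "B N \<subseteq> B (g N)" using dec[of "g N" N] by simp
      then show False using g[of N] by (metis Diff_eq_empty_iff finite.emptyI)
    qed
    then have mono: "strict_mono k" by (simp add: strict_mono_Suc_iff k_Suc)
    define E where "E i = B (k i)" for i
    have E: "decseq E" "infinite (E i - E (Suc i))" for i
      using g dec mono by (auto simp: E_def decseq_def k_Suc strict_mono_less_eq)
    have "star (E n) \<subseteq> star (B n)" for n
      unfolding E_def by (rule star_subset[OF dec[OF seq_suble[OF mono]]])
    then have K: "K = (\<Inter>i. star (E i))" using B(2) by (auto simp: E_def)
    \<comment> \<open>One reserved member per \<open>n\<close>; distinct hues make them distinct,
      and members of hue \<open>Inr \<phi>\<close> remain available as parts.\<close>
    have "\<exists>A\<in>\<A>. hue A = Inl n" for n using hue[OF not_small_UNIV] by blast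
    then obtain A where A: "\<And>n. A n \<in> \<A>" "\<And>n. hue (A n) = Inl n" by metis
    have "inj A" by (rule injI) (metis A(2) Inl_inject)
    obtain h where "inj h" "(\<Inter>i. star (E i)) = star (range h) - (\<Union>i. star (h ` A i))"
      by (rule columns_chart[OF E A(1) \<open>inj A\<close>])
    then show ?thesis by (intro that[of h "range A"]) (use A K in auto)
  qed
qed

text \<open>The chart \<open>h\<close> transports everything: the parts are the images of the
  members outside \<open>\<A>\<^sub>0\<close>, and \<open>h\<close> maps \<open>free\<close> into
  the remainder.\<close>

lemma cell_splits_resolves:
  assumes "K \<in> star_cells"
  shows "\<exists>\<D> (c :: nat filter set \<Rightarrow> fm) (l :: nat filter \<Rightarrow> fm).
    splits omega_star star_cells K \<D> c \<and> resolves omega_star (K - \<Union>\<D>) l"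
proof (cases "K = {}")
  case True
  then show ?thesis by (intro exI[of _ "{}"]) (simp add: splits_def resolves_def)
next
  case False
  obtain h \<A>\<^sub>0 where h: "inj h" and A0: "\<A>\<^sub>0 \<subseteq> \<A>" "\<And>A. A \<in> \<A>\<^sub>0 \<Longrightarrow> \<exists>n. hue A = Inl n"
    and K: "K = star (range h) - (\<Union>A\<in>\<A>\<^sub>0. star (h ` A))"
    by (rule cell_chart[OF assms False]) (rule that)
  define D where "D A = star (h ` A)" for A
  have inf: "infinite (h ` A)" if "A \<in> \<A>" for A
    using infinite_member[OF that] finite_imageD inj_on_subset[OF h] by blast
  have D_nonempty: "D A \<noteq> {}" if "A \<in> \<A>" for A
    unfolding D_def using star_nonempty[OF inf[OF that]] .
  have D_disjoint: "D A \<inter> D B = {}" if "A \<in> \<A>" "B \<in> \<A>" "A \<noteq> B" for A B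
  proof -
    have "h ` A \<inter> h ` B = h ` (A \<inter> B)" using image_Int[OF h] by blast
    then have "finite (h ` A \<inter> h ` B)" using almost_disjoint[OF that] by simp
    then show ?thesis unfolding D_def using star_Int star_finite by metis
  qed
  then have D_inj: "inj_on D \<A>" using D_nonempty by (metis Int_absorb inj_onI)
  define \<D> where "\<D> = D ` (\<A> - \<A>\<^sub>0)"
  \<comment> \<open>Reserved members outside \<open>\<A>\<^sub>0\<close> are parts too; their colour
    \<open>Bot\<close> is a mere default.\<close>
  define c where "c = (\<lambda>X. case hue (inv_into \<A> D X) of Inl _ \<Rightarrow> Bot | Inr \<phi> \<Rightarrow> \<phi>)"
  have rest: "K - \<Union>\<D> = star (range h) - (\<Union>A\<in>\<A>. D A)"
    using A0(1) unfolding K \<D>_def D_def by blast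
  have free_map: "filtermap h p \<in> K - \<Union>\<D>" if p: "p \<in> free" for p
  proof -
    have top: "p \<in> topspace omega_star" using p by (simp add: free_def)
    have "filtermap h p \<in> D A \<longleftrightarrow> p \<in> star A" for A
      unfolding D_def filtermap_in_star_iff[OF h top] inj_vimage_image_eq[OF h] ..
    moreover have "filtermap h p \<in> star (range h)"
      using top unfolding filtermap_in_star_iff[OF h top] by (simp add: star_def)
    ultimately show ?thesis using p unfolding rest by (auto simp: free_def)
  qed
  \<comment> \<open>A small preimage would place \<open>x\<close> in one of finitely many
    \<open>D A\<close>, all of which the remainder avoids. Thus every neighbourhood pulls back to a
    set to which \<open>hue\<close> and \<open>mark_free\<close> apply.\<close>
  have not_small: "\<not> small (h -` Y)" if x: "x \<in> K - \<Union>\<D>" "x \<in> star Y" for x Y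
  proof
    assume "small (h -` Y)"
    then obtain \<F> where \<F>: "\<F> \<subseteq> \<A>" "finite \<F>" "finite (h -` Y - \<Union>\<F>)" by (auto simp: small_def)
    have "Y \<inter> range h - (\<Union>A\<in>\<F>. h ` A) \<subseteq> h ` (h -` Y - \<Union>\<F>)" by blast
    then have "finite (Y \<inter> range h - (\<Union>A\<in>\<F>. h ` A))" using \<F>(3) finite_subset by blast
    then have "star (Y \<inter> range h) \<subseteq> (\<Union>A\<in>\<F>. D A)"
      unfolding D_def star_UN[OF \<F>(2), symmetric] by (rule star_mono)
    then show False using x \<F>(1) unfolding rest star_Int by blast
  qed
  have "splits omega_star star_cells K \<D> c"
    unfolding splits_def
  proof (intro conjI ballI allI impI)
    fix X assume "X \<in> \<D>"
    then obtain A where A: "A \<in> \<A>" "A \<notin> \<A>\<^sub>0" "X = D A" by (auto simp: \<D>_def)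
    have "X = {p \<in> topspace omega_star. \<forall>B\<in>{h ` A}. p \<in> star B}"
      unfolding A(3) D_def by (auto simp: star_def)
    then show "X \<in> star_cells"
      unfolding star_cells_def by (intro CollectI exI[of _ "{h ` A}"] conjI) simp_all
    show "openin omega_star X" unfolding A(3) D_def by (rule openin_star)
    show "X \<subseteq> K"
      using star_subset[of "h ` A" "range h"] D_disjoint[OF A(1)] A A0(1) unfolding K D_def by blast
    show "X \<noteq> {}" using D_nonempty A by simp
  next
    fix X X' assume "X \<in> \<D>" "X' \<in> \<D>" "X \<noteq> X'"
    then show "X \<inter> X' = {}" using D_disjoint unfolding \<D>_def by blast
  next
    obtain p where "p \<in> free" using mark_free[OF not_small_UNIV] by blast
    then show "K - \<Union>\<D> \<noteq> {}" using free_map by blast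
  next
    fix x U \<phi> assume x: "x \<in> K - \<Union>\<D>" and U: "openin omega_star U" "x \<in> U"
    obtain Y where Y: "x \<in> star Y" "star Y \<subseteq> U" by (rule omega_star_base[OF U])
    obtain A where A: "A \<in> \<A>" "finite (A - h -` Y)" "hue A = Inr \<phi>"
      using hue[OF not_small[OF x Y(1)]] by blast
    have "A \<notin> \<A>\<^sub>0" using A0(2) A(3) by force
    moreover have "h ` A - Y \<subseteq> h ` (A - h -` Y)" by blast
    then have "finite (h ` A - Y)" using A(2) finite_subset by blast
    then have "D A \<subseteq> U" using star_mono Y(2) unfolding D_def by blast
    moreover have "c (D A) = \<phi>" by (simp add: c_def D_inj A)
    ultimately show "\<exists>X\<in>\<D>. X \<subseteq> U \<and> c X = \<phi>" using A(1) unfolding \<D>_def by blast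
  qed
  \<comment> \<open>\<open>filtercomap h\<close> undoes the embedding \<open>filtermap h\<close>, so
    images of points of \<open>free\<close> keep their marks.\<close>
  moreover have "resolves omega_star (K - \<Union>\<D>) (mark \<circ> filtercomap h)"
    unfolding resolves_def
  proof (intro ballI allI impI)
    fix x U \<phi> assume x: "x \<in> K - \<Union>\<D>" and U: "openin omega_star U" "x \<in> U"
    obtain Y where Y: "x \<in> star Y" "star Y \<subseteq> U" by (rule omega_star_base[OF U])
    obtain p where p: "p \<in> star (h -` Y)" "p \<in> free" "mark p = \<phi>"
      using mark_free[OF not_small[OF x Y(1)]] by blast
    have "p \<in> topspace omega_star" using p(2) by (simp add: free_def)
    then have "filtermap h p \<in> star Y" using p(1) filtermap_in_star_iff[OF h] by blast
    moreover have "(mark \<circ> filtercomap h) (filtermap h p) = \<phi>"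
      using p(3) by (simp add: filtercomap_filtermap_inj[OF h])
    ultimately show "\<exists>q\<in>U \<inter> (K - \<Union>\<D>). (mark \<circ> filtercomap h) q = \<phi>"
      using Y(2) free_map[OF p(2)] by blast
  qed
  ultimately show ?thesis by blast
qed

text \<open>A cell has dense interior: each neighbourhood of a point of \<open>K\<close> contains a
  whole part or meets the open part around that point. On nonempty open sets \<open>mark\<close>
  takes every value.\<close>

lemma cell_resolves_mark:
  assumes "K \<in> star_cells"
  shows "resolves omega_star K mark"
  unfolding resolves_def
proof (intro ballI allI impI)
  fix x U \<phi> assume x: "x \<in> K" and U: "openin omega_star U" "x \<in> U"
  obtain \<D> and c :: "nat filter set \<Rightarrow> fm" where sp: "splits omega_star star_cells K \<D> c"
    using cell_splits_resolves[OF assms] by blast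
  have "\<exists>W y. openin omega_star W \<and> y \<in> W \<and> W \<subseteq> U \<inter> K"
  proof (cases "x \<in> \<Union>\<D>")
    case True
    then obtain X where X: "X \<in> \<D>" "x \<in> X" by blast
    then have "openin omega_star X" "X \<subseteq> K" using sp by (auto simp: splits_def)
    then show ?thesis using U X by (intro exI[of _ "U \<inter> X"] exI[of _ x]) auto
  next
    case False
    then obtain X where X: "X \<in> \<D>" "X \<subseteq> U" using splitsD[OF sp _ U] x by blast
    then have "openin omega_star X" "X \<subseteq> K" "X \<noteq> {}" using sp by (auto simp: splits_def)
    then show ?thesis using X(2) by blast
  qed
  then obtain W y where W: "openin omega_star W" "y \<in> W" "W \<subseteq> U \<inter> K" by blast
  obtain Z where Z: "y \<in> star Z" "star Z \<subseteq> W" by (rule omega_star_base[OF W(1,2)])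
  then have "infinite Z" using star_finite by blast
  then show "\<exists>q\<in>U \<inter> K. mark q = \<phi>" using mark Z(2) W(3) by blast
qed

lemma cell_space_omega_star: "cell_space omega_star star_cells"
proof
  show "topspace omega_star \<noteq> {}" using star_nonempty[of UNIV] by (simp add: star_UNIV)
  show "topspace omega_star \<in> star_cells"
    unfolding star_cells_def by (intro CollectI exI[of _ "{}"]) simp
  show "\<Inter>M \<in> star_cells" if M: "M \<noteq> {}" "M \<subseteq> star_cells" "countable M" for M
  proof -
    have "\<forall>K\<in>M. \<exists>\<B>. countable \<B> \<and>
        (\<forall>p. p \<in> K \<longleftrightarrow> p \<in> topspace omega_star \<and> (\<forall>B\<in>\<B>. p \<in> star B))"
    proof
      fix K assume "K \<in> M"
      then have "K \<in> star_cells" using M(2) by blast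
      then show "\<exists>\<B>. countable \<B> \<and>
          (\<forall>p. p \<in> K \<longleftrightarrow> p \<in> topspace omega_star \<and> (\<forall>B\<in>\<B>. p \<in> star B))"
        by (simp add: star_cells_def set_eq_iff)
    qed
    from bchoice[OF this] obtain \<B> where \<B>: "\<forall>K\<in>M. countable (\<B> K) \<and>
        (\<forall>p. p \<in> K \<longleftrightarrow> p \<in> topspace omega_star \<and> (\<forall>B\<in>\<B> K. p \<in> star B))"
      by (rule exE)
    then have mem: "p \<in> K \<longleftrightarrow> p \<in> topspace omega_star \<and> (\<forall>B\<in>\<B> K. p \<in> star B)" if "K \<in> M" for K p
      using that by simp
    have "\<Inter>M = {p \<in> topspace omega_star. \<forall>B\<in>(\<Union>K\<in>M. \<B> K). p \<in> star B}"
      using M(1) by (auto simp: mem)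
    moreover have "countable (\<Union>K\<in>M. \<B> K)" using M(3) \<B> by simp
    ultimately show ?thesis unfolding star_cells_def by (intro CollectI exI conjI)
  qed
  show "\<exists>l :: nat filter \<Rightarrow> fm. resolves omega_star K l" if "K \<in> star_cells" for K
    using cell_resolves_mark[OF that] by blast
qed (rule cell_splits_resolves)

end

theorem theorem4p2:
  assumes "\<exists>\<A>. MAD_family \<A> \<and> completely_separable \<A>"
  shows "\<forall>(\<Gamma> :: fm set) (\<phi> :: fm). S4_derives \<Gamma> \<phi> \<longleftrightarrow> models_space omega_star \<Gamma> \<phi>"
proof -
  obtain \<A> where "MAD_family \<A>" "completely_separable \<A>" using assms by blast
  then interpret completely_separable_mad \<A> by unfold_locales
  obtain hue mark where "coloured_mad \<A> hue mark" by (rule coloured_mad_exists)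
  then interpret coloured_mad \<A> hue mark .
  interpret cell_space omega_star star_cells by (rule cell_space_omega_star)
  show ?thesis
  proof (intro allI iffI)
    show "models_space omega_star \<Gamma> \<phi>" if "S4_derives \<Gamma> \<phi>" for \<Gamma> \<phi>
      unfolding models_space_def by (intro allI impI S4_derives_sound[OF that])
  qed (rule S4_strongly_complete)
qed

end
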